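(* Assume the observation model for $X$, the exchangeable exponential moment condition on $\xi$ with constants $\beta\in(0,1]$, $B>0$, the empirical Bayes construction with prior parameter $\varkappa$, and the second-sample condition on $X'=\theta+\sigma\xi'$ with functions $\psi_1,\psi_2$, all described in the context, and assume $\varkappa>\bar\varkappa:=(12-\beta+4B)/(4\beta)$. Let $\hat\theta$ be either $\tilde\theta$ or $\check\theta$ (based on the sample $X$). Then there exist constants $M_1,H_1,m_1>0$, depending only on $\beta,B,\varkappa$, such that, with $$G_M=\sqrt{M(M+M_1)},\qquad \tilde R_M^2=\big(\|X'-\hat\theta\|^2-n\sigma^2+2\sigma^2G_M\sqrt n\big)_+,$$ $$g_M(\theta,n)=M_1r^2(\theta)+M\sigma^2+4\sigma^2G_M\sqrt n,$$ one has for any $M\ge0$ $$\sup_{\theta\in\mathbb{R}^n}\mathrm{P}_\theta\big(\theta\notin B(\hat\theta,\tilde R_M)\big)\le\psi_1(M/4)+\psi_2(M)+H_1e^{-m_1M},$$ $$\sup_{\theta\in\mathbb{R}^n}\mathrm{P}_\theta\big(\tilde R_M^2\ge g_M(\theta,n)\big)\le\psi_1(M/4)+\psi_2(M)+2H_1e^{-m_1M}.$$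
   Context: Model. $n\in\mathbb{N}$, $[n]=\{1,\dots,n\}$, $\sigma>0$ known, $\theta\in\mathbb{R}^n$ unknown. One observes $X=(X_1,\dots,X_n)$, $X_i=\theta_i+\sigma\xi_i$, $i\in[n]$, where $\xi=(\xi_1,\dots,\xi_n)$ is a random vector (its distribution is unknown, may depend on $\theta$, and its coordinates need not be independent or normal) with $\mathrm{E}\xi_i=0$, $\mathrm{Var}(\xi_i)\le 1$. $\|\cdot\|$ is the Euclidean norm, $\langle\cdot,\cdot\rangle$ the scalar product, $x_+=\max\{x,0\}$, and $B(\hat\theta,R)=\{\theta\in\mathbb{R}^n:\|\hat\theta-\theta\|\le R\}$. Exchangeable exponential moment condition with constants $\beta\in(0,1]$, $B>0$: $\mathrm{E}\exp\{\beta\sum_{i\in I}\xi_i^2\}\le e^{B|I|}$ for all $I\subseteq[n]$ (for every $\theta$, if the law of $\xi$ depends on $\theta$). Second-sample condition. Besides $X$ one observes $X'\in\mathbb{R}^n$ independent of $X$, $X'=\theta+\sigma\xi'$, where $\mathrm{E}\xi'_i=0$, $\mathrm{Var}(\xi'_i)=1$ for $i\in[n]$, and for all $M\ge0$ $$\mathrm{P}\big(|\langle v,\xi'\rangle|\ge\sqrt M\big)\le\psi_1(M)\ \ \forall v\in\mathbb{R}^n\text{ with }\|v\|=1;\qquad \mathrm{P}\big(\big|\|\xi'\|^2-\mathrm{E}\|\xi'\|^2\big|\ge M\sqrt n\big)\le\psi_2(M),$$ where $\psi_1,\psi_2$ are positive monotonically decreasing functions with $\psi_1(M)\downarrow0$,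 $\psi_2(M)\downarrow0$ as $M\uparrow\infty$. $\mathrm{P}_\theta,\mathrm{E}_\theta$ denote the joint law of $(X,X')$ and its expectation. Conventions. $\mathcal{I}$ is the family of all subsets of $[n]$ (including $\varnothing$), $I^c=[n]\setminus I$, $0\log(c/0)=0$ and $(c/0)^0=1$ for $c>0$, $\phi(x,\mu,s^2)$ is the $\mathrm{N}(\mu,s^2)$ density at $x$, $X(I)=(X_i\mathbf{1}\{i\in I\})_{i\in[n]}$. Empirical Bayes construction (based on $X$). Fix $\varkappa>1$. Let $\lambda_I=c_{\varkappa,n}(en/|I|)^{-\varkappa|I|}$, $I\in\mathcal{I}$, with $c_{\varkappa,n}$ normalizing so that $\sum_{I}\lambda_I=1$; $K_n(I)=(\frac{en}{|I|}-1)\mathbf{1}\{I\ne\varnothing\}$; $\tau_i^2(I)=\sigma^2K_n(I)\mathbf{1}\{i\in I\}$; $\mathrm{P}_{X,I}=\prod_{i=1}^n\phi(X_i,X_i\mathbf{1}\{i\in I\},\sigma^2+\tau_i^2(I))$. Define $\tilde\pi(I|X)=\lambda_I\mathrm{P}_{X,I}/\sum_{J\in\mathcal{I}}\lambda_J\mathrm{P}_{X,J}$; $\tilde\theta=\sum_{I}X(I)\tilde\pi(I|X)$; $\hat I$ any maximizer of $\tilde\pi(I|X)$ over $I\in\mathcal{I}$, equivalently any minimizer of $\sum_{i\in I^c}X_i^2+(2\varkappa+1)\sigma^2|I|\log(\frac{en}{|I|})$; $\check\theta=X(\hat I)$. Oracle rate. $r^2(\theta)=\min_{I\in\mathcal{I}}\big\{\sum_{i\in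 I^c}\theta_i^2+\sigma^2|I|\log(\frac{en}{|I|})\big\}$. *)

theory Defs
  imports "HOL-Probability.Probability"
begin

(* R^n is modelled by the functions on {1..n} (extensional outside), with n an ordinary
   natural number, so that constants can be required not to depend on n. *)
type_synonym vec = "nat \<Rightarrow> real"

abbreviation Rn :: "nat \<Rightarrow> vec measure" where
  "Rn n \<equiv> (\<Pi>\<^sub>M i\<in>{1..n}. borel)"

definition vnorm :: "nat \<Rightarrow> vec \<Rightarrow> real" where
  "vnorm n v = L2_set v {1..n}"

definition scalar :: "nat \<Rightarrow> vec \<Rightarrow> vec \<Rightarrow> real" where
  "scalar n v w = (\<Sum>i\<in>{1..n}. v i * w i)"

definition vball :: "nat \<Rightarrow> vec \<Rightarrow> real \<Rightarrow> vec set" where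
  "vball n c R = {\<theta> \<in> space (Rn n). vnorm n (\<lambda>i. c i - \<theta> i) \<le> R}"

section \<open>Observation model\<close>

definition observe :: "nat \<Rightarrow> real \<Rightarrow> vec \<Rightarrow> vec \<Rightarrow> vec" where
  "observe n \<sigma> \<theta> \<xi> = (\<lambda>i\<in>{1..n}. \<theta> i + \<sigma> * \<xi> i)"

(* N is the joint law of the pair of noise vectors, the first component being the noise of
   the sample X and the second one that of X'. *)
definition joint_law :: "nat \<Rightarrow> real \<Rightarrow> vec \<Rightarrow> (vec \<times> vec) measure \<Rightarrow> (vec \<times> vec) measure" where
  "joint_law n \<sigma> \<theta> N = distr N (Rn n \<Otimes>\<^sub>M Rn n)
     (\<lambda>(\<xi>, \<xi>'). (observe n \<sigma> \<theta> \<xi>, observe n \<sigma> \<theta> \<xi>'))"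

(* Integrability of the squares is stated separately, since the Bochner integral of a
   non-integrable function is 0. *)
definition noise_moments :: "nat \<Rightarrow> (vec \<times> vec) measure \<Rightarrow> bool" where
  "noise_moments n N \<longleftrightarrow> (\<forall>i\<in>{1..n}.
     integrable N (\<lambda>\<omega>. fst \<omega> i) \<and> integrable N (\<lambda>\<omega>. (fst \<omega> i)\<^sup>2) \<and>
     prob_space.expectation N (\<lambda>\<omega>. fst \<omega> i) = 0 \<and>
     prob_space.variance N (\<lambda>\<omega>. fst \<omega> i) \<le> 1)"

(* The expectation is a Lebesgue integral with values in [0, \<infinity>], so the bound
   includes its finiteness. *)
definition exch_exp_moment :: "nat \<Rightarrow> real \<Rightarrow> real \<Rightarrow> (vec \<times> vec) measure \<Rightarrow> bool" where
  "exch_exp_moment n \<beta> B N \<longleftrightarrow> (\<forall>I\<subseteq>{1..n}.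
     (\<integral>\<^sup>+ \<omega>. ennreal (exp (\<beta> * (\<Sum>i\<in>I. (fst \<omega> i)\<^sup>2))) \<partial>N) \<le> ennreal (exp (B * real (card I))))"

definition tail_function :: "(real \<Rightarrow> real) \<Rightarrow> bool" where
  "tail_function \<psi> \<longleftrightarrow> (\<forall>M\<ge>0. 0 < \<psi> M) \<and> antimono_on {0..} \<psi> \<and> (\<psi> \<longlongrightarrow> 0) at_top"

definition second_noise ::
    "nat \<Rightarrow> (real \<Rightarrow> real) \<Rightarrow> (real \<Rightarrow> real) \<Rightarrow> (vec \<times> vec) measure \<Rightarrow> bool" where
  "second_noise n \<psi>1 \<psi>2 N \<longleftrightarrow>
     (\<forall>i\<in>{1..n}.
        integrable N (\<lambda>\<omega>. snd \<omega> i) \<and> integrable N (\<lambda>\<omega>. (snd \<omega> i)\<^sup>2) \<and>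
        prob_space.expectation N (\<lambda>\<omega>. snd \<omega> i) = 0 \<and>
        prob_space.variance N (\<lambda>\<omega>. snd \<omega> i) = 1) \<and>
     (\<forall>M\<ge>0. \<forall>v\<in>space (Rn n). vnorm n v = 1 \<longrightarrow>
        measure N {\<omega> \<in> space N. \<bar>scalar n v (snd \<omega>)\<bar> \<ge> sqrt M} \<le> \<psi>1 M) \<and>
     (\<forall>M\<ge>0. measure N {\<omega> \<in> space N.
        \<bar>(vnorm n (snd \<omega>))\<^sup>2 - prob_space.expectation N (\<lambda>\<omega>. (vnorm n (snd \<omega>))\<^sup>2)\<bar> \<ge> M * sqrt (real n)}
        \<le> \<psi>2 M)"

definition admissible_noise ::
    "nat \<Rightarrow> real \<Rightarrow> real \<Rightarrow> real \<Rightarrow> (real \<Rightarrow> real) \<Rightarrow> (real \<Rightarrow> real) \<Rightarrow> vec \<Rightarrow> (vec \<times> vec) measure \<Rightarrow> bool" where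
  "admissible_noise n \<sigma> \<beta> B \<psi>1 \<psi>2 \<theta> N \<longleftrightarrow>
     prob_space N \<and> sets N = sets (Rn n \<Otimes>\<^sub>M Rn n) \<and>
     noise_moments n N \<and> exch_exp_moment n \<beta> B N \<and> second_noise n \<psi>1 \<psi>2 N \<and>
     prob_space.indep_var N (Rn n) (\<lambda>\<omega>. observe n \<sigma> \<theta> (fst \<omega>))
                            (Rn n) (\<lambda>\<omega>. observe n \<sigma> \<theta> (snd \<omega>))"

section \<open>Empirical Bayes construction\<close>

definition restr :: "nat \<Rightarrow> vec \<Rightarrow> nat set \<Rightarrow> vec" where
  "restr n x I = (\<lambda>i\<in>{1..n}. x i * indicator I i)"

(* The case distinction is the convention (c/0)^0 = 1; in HOL, 0 powr 0 = 0. *)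
definition prior_weight :: "real \<Rightarrow> nat \<Rightarrow> nat set \<Rightarrow> real" where
  "prior_weight \<kappa> n I =
     (if I = {} then 1 else (exp 1 * real n / real (card I)) powr (- \<kappa> * real (card I)))"

definition prior :: "real \<Rightarrow> nat \<Rightarrow> nat set \<Rightarrow> real" where
  "prior \<kappa> n I = prior_weight \<kappa> n I / (\<Sum>J\<in>Pow {1..n}. prior_weight \<kappa> n J)"

definition Kn :: "nat \<Rightarrow> nat set \<Rightarrow> real" where
  "Kn n I = (if I = {} then 0 else exp 1 * real n / real (card I) - 1)"

definition tau2 :: "nat \<Rightarrow> real \<Rightarrow> nat set \<Rightarrow> nat \<Rightarrow> real" where
  "tau2 n \<sigma> I i = \<sigma>\<^sup>2 * Kn n I * indicator I i"

(* The second argument of normal_density is the standard deviation. *)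
definition marginal :: "nat \<Rightarrow> real \<Rightarrow> vec \<Rightarrow> nat set \<Rightarrow> real" where
  "marginal n \<sigma> x I =
     (\<Prod>i\<in>{1..n}. normal_density (x i * indicator I i) (sqrt (\<sigma>\<^sup>2 + tau2 n \<sigma> I i)) (x i))"

definition posterior :: "real \<Rightarrow> nat \<Rightarrow> real \<Rightarrow> vec \<Rightarrow> nat set \<Rightarrow> real" where
  "posterior \<kappa> n \<sigma> x I = prior \<kappa> n I * marginal n \<sigma> x I /
     (\<Sum>J\<in>Pow {1..n}. prior \<kappa> n J * marginal n \<sigma> x J)"

definition theta_tilde :: "real \<Rightarrow> nat \<Rightarrow> real \<Rightarrow> vec \<Rightarrow> vec" where
  "theta_tilde \<kappa> n \<sigma> x = (\<lambda>i\<in>{1..n}. \<Sum>I\<in>Pow {1..n}. restr n x I i * posterior \<kappa> n \<sigma> x I)"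

(* Maximizers need not be unique; the choice among them has to be measurable for the resulting
   estimator to be a random vector. *)
definition posterior_mode :: "real \<Rightarrow> nat \<Rightarrow> real \<Rightarrow> (vec \<Rightarrow> nat set) \<Rightarrow> bool" where
  "posterior_mode \<kappa> n \<sigma> Ihat \<longleftrightarrow> Ihat \<in> measurable (Rn n) (count_space (Pow {1..n})) \<and>
     (\<forall>x\<in>space (Rn n). is_arg_max (posterior \<kappa> n \<sigma> x) (\<lambda>I. I \<in> Pow {1..n}) (Ihat x))"

definition theta_check :: "nat \<Rightarrow> (vec \<Rightarrow> nat set) \<Rightarrow> vec \<Rightarrow> vec" where
  "theta_check n Ihat x = restr n x (Ihat x)"

section \<open>Oracle rate and confidence ball\<close>

(* For I = {} the second summand is 0 * ln 0 = 0, as in the convention 0 log (c/0) = 0. *)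
definition oracle_rate2 :: "nat \<Rightarrow> real \<Rightarrow> vec \<Rightarrow> real" where
  "oracle_rate2 n \<sigma> \<theta> = (MIN I\<in>Pow {1..n}. (\<Sum>i\<in>{1..n} - I. (\<theta> i)\<^sup>2) +
     \<sigma>\<^sup>2 * real (card I) * ln (exp 1 * real n / real (card I)))"

definition GM :: "real \<Rightarrow> real \<Rightarrow> real" where
  "GM M1 M = sqrt (M * (M + M1))"

definition radius2 :: "real \<Rightarrow> nat \<Rightarrow> real \<Rightarrow> real \<Rightarrow> vec \<Rightarrow> vec \<Rightarrow> real" where
  "radius2 M1 n \<sigma> M t x' =
     max ((vnorm n (\<lambda>i. x' i - t i))\<^sup>2 - real n * \<sigma>\<^sup>2 + 2 * \<sigma>\<^sup>2 * GM M1 M * sqrt (real n)) 0"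

definition gM :: "real \<Rightarrow> nat \<Rightarrow> real \<Rightarrow> real \<Rightarrow> vec \<Rightarrow> real" where
  "gM M1 n \<sigma> M \<theta> = M1 * oracle_rate2 n \<sigma> \<theta> + M * \<sigma>\<^sup>2 + 4 * \<sigma>\<^sup>2 * GM M1 M * sqrt (real n)"

end

theory Submission
  imports Defs
begin

text \<open>
  Write \<open>\<rho>(I) = |I| log (en / |I|)\<close>. Up to normalization the posterior is
  \<open>exp (- crit I / (2 \<sigma>\<^sup>2))\<close> with \<open>crit I = \<Sum>\<^sub>i\<^sub>\<notin>\<^sub>I X\<^sub>i\<^sup>2 + (2 \<kappa> + 1) \<sigma>\<^sup>2 \<rho>(I)\<close>.
  By Markov's inequality and a union bound over \<open>I\<close> (there are at most \<open>exp (\<rho>(I))\<close> sets of size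
  \<open>|I|\<close>), outside an event of probability \<open>O(exp (- L))\<close> one has
  \<open>\<Sum>\<^sub>i\<^sub>\<in>\<^sub>I \<xi>\<^sub>i\<^sup>2 \<le> ((2 + B) \<rho>(I) + L) / \<beta>\<close> for all \<open>I\<close> simultaneously. There the lower bound on \<open>\<kappa>\<close>
  makes \<open>crit I\<close> exceed its value at the oracle set by a multiple of the oracle term of \<open>I\<close>, up to
  \<open>O(r\<^sup>2 + \<sigma>\<^sup>2 L)\<close>, with enough room left to sum the posterior over all sets; so both estimators have
  squared loss at most \<open>M\<^sub>1 r\<^sup>2 + \<sigma>\<^sup>2 M\<close>, where \<open>M = M\<^sub>1 L + const\<close>.

  With \<open>D = \<theta> - \<theta>hat\<close> the expansion
  \<open>\<parallel>X' - \<theta>hat\<parallel>\<^sup>2 = \<parallel>D\<parallel>\<^sup>2 + 2 \<sigma> \<langle>D, \<xi>'\<rangle> + \<sigma>\<^sup>2 \<parallel>\<xi>'\<parallel>\<^sup>2\<close> reduces both claims to the last two terms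
  deviating from \<open>n \<sigma>\<^sup>2\<close> by less than \<open>2 \<sigma>\<^sup>2 G\<^sub>M \<surd>n\<close>. Since \<open>r\<^sup>2 \<le> n \<sigma>\<^sup>2\<close>, the loss bound gives
  \<open>\<parallel>D\<parallel> \<le> \<sigma> \<surd>n \<surd>(M + M\<^sub>1)\<close>, which is what makes \<open>G\<^sub>M\<close> match the tail function at \<open>M / 4\<close>.
\<close>

section \<open>Complexity of an index set\<close>

definition model_complexity :: "nat \<Rightarrow> nat set \<Rightarrow> real" where
  "model_complexity n I = real (card I) * ln (exp 1 * real n / real (card I))"

definition oracle_term :: "nat \<Rightarrow> real \<Rightarrow> vec \<Rightarrow> nat set \<Rightarrow> real" where
  "oracle_term n \<sigma> \<theta> I = (\<Sum>i\<in>{1..n} - I. (\<theta> i)\<^sup>2) + \<sigma>\<^sup>2 * model_complexity n I"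

definition crit :: "real \<Rightarrow> nat \<Rightarrow> real \<Rightarrow> vec \<Rightarrow> nat set \<Rightarrow> real" where
  "crit \<kappa> n \<sigma> x I = (\<Sum>i\<in>{1..n} - I. (x i)\<^sup>2) + (2 * \<kappa> + 1) * \<sigma>\<^sup>2 * model_complexity n I"

text \<open>As |I| <= n, the logarithm is at least log e = 1. Terms linear in |I|, such as the
  exponent B |I| of the moment condition, can thus be absorbed into the complexity.\<close>

lemma card_le_model_complexity:
  assumes "I \<subseteq> {1..n}"
  shows "real (card I) \<le> model_complexity n I"
proof (cases "card I = 0")
  case False
  have "card I \<le> n" using card_mono[OF _ assms] by simp
  then have "exp 1 \<le> exp 1 * real n / real (card I)"
    using False by (simp add: field_simps)
  then have "1 \<le> ln (exp 1 * real n / real (card I))"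
    using False \<open>card I \<le> n\<close> by (subst ln_ge_iff) auto
  then show ?thesis
    unfolding model_complexity_def by (metis mult.right_neutral mult_left_mono of_nat_0_le_iff)
qed (simp add: model_complexity_def)

lemma model_complexity_nonneg: "I \<subseteq> {1..n} \<Longrightarrow> 0 \<le> model_complexity n I"
  using card_le_model_complexity[of I n] by linarith

lemma exp_model_complexity:
  assumes "I \<subseteq> {1..n}" "I \<noteq> {}"
  shows "exp (model_complexity n I) = (exp 1 * real n / real (card I)) ^ card I"
proof -
  have "finite I" using assms finite_subset by blast
  then have c: "card I > 0" using assms by (simp add: card_gt_0_iff)
  moreover have "card I \<le> n" using card_mono[OF _ assms(1)] by simp
  ultimately have "exp 1 * real n / real (card I) > 0" by simp
  then show ?thesis by (simp add: model_complexity_def exp_of_nat_mult)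
qed

lemma binomial_le_exp_power:
  assumes "0 < k" "k \<le> n"
  shows "real (n choose k) \<le> (exp 1 * real n / real k) ^ k"
proof -
  \<comment> \<open>one term of the binomial expansion of \<open>(1 + y)^n \<le> exp (n y)\<close> at \<open>y = k / n\<close>\<close>
  define y where "y = real k / real n"
  have y: "y > 0" using assms by (simp add: y_def)
  have "real (n choose k) * y ^ k \<le> (\<Sum>j\<le>n. real (n choose j) * y ^ j)"
    using assms y by (intro member_le_sum) auto
  also have "\<dots> = (y + 1) ^ n" using binomial_ring[of y 1 n] by simp
  also have "\<dots> \<le> exp y ^ n" using y exp_ge_add_one_self[of y] by (intro power_mono) (auto simp: add.commute)
  also have "\<dots> = exp 1 ^ k" using assms by (simp add: exp_of_nat_mult[symmetric] y_def)
  finally have "real (n choose k) \<le> exp 1 ^ k / y ^ k" using y by (simp add: field_simps)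
  also have "\<dots> = (exp 1 / y) ^ k" by (simp add: power_divide)
  also have "exp 1 / y = exp 1 * real n / real k" by (simp add: y_def)
  finally show ?thesis .
qed

text \<open>The sum of the geometric series with ratio exp(-1/8). The rate 1/8 is what is left over
  for |I| in the exponent of the posterior bound \<open>posterior_oracle_term_le\<close>.\<close>

definition sparsity_const :: real where "sparsity_const = 1 / (1 - exp (- 1 / 8))"

lemma sparsity_const_ge_1: "1 \<le> sparsity_const"
  by (simp add: sparsity_const_def field_simps)

text \<open>Grouping by size k, the number of sets is at most the exponential of their common
  complexity, so only exp(-k/8) survives in each group. The bound is free of n and serves both the
  union bound over noise events and the summation of the posterior over all sets.\<close>

lemma sum_exp_model_complexity:
  "(\<Sum>I\<in>Pow {1..n}. exp (- model_complexity n I - real (card I) / 8)) \<le> sparsity_const"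
proof -
  let ?f = "\<lambda>I. exp (- model_complexity n I - real (card I) / 8)"
  let ?q = "exp (- 1 / 8 :: real)"
  have "(\<Sum>I\<in>Pow {1..n}. ?f I) = (\<Sum>k\<in>{..n}. \<Sum>I\<in>{I\<in>Pow {1..n}. card I = k}. ?f I)"
  proof (rule sum.group[symmetric])
    show "card ` Pow {1..n} \<subseteq> {..n}" using card_mono[of "{1..n}"] by fastforce
  qed auto
  also have "\<dots> \<le> (\<Sum>k\<in>{..n}. ?q ^ k)"
  proof (rule sum_mono)
    fix k assume "k \<in> {..n}"
    show "(\<Sum>I\<in>{I\<in>Pow {1..n}. card I = k}. ?f I) \<le> ?q ^ k"
    proof (cases "k = 0")
      case True
      have "{I\<in>Pow {1..n}. card I = 0} = {{}}"
        by (auto dest: finite_subset)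
      then show ?thesis using True by (simp add: model_complexity_def)
    next
      case False
      have eq: "?f I = inverse ((exp 1 * real n / real k) ^ k) * ?q ^ k"
        if "I \<in> {I\<in>Pow {1..n}. card I = k}" for I
      proof -
        have "I \<noteq> {}" using that False by auto
        have "?f I = inverse (exp (model_complexity n I)) * exp (- real (card I) / 8)"
          by (simp add: exp_minus[symmetric] exp_add[symmetric])
        also have "exp (- real (card I) / 8) = ?q ^ k"
          using that by (simp add: exp_of_nat_mult[symmetric])
        finally show ?thesis
          using exp_model_complexity[of I n] that \<open>I \<noteq> {}\<close> by simp
      qed
      have "card {I\<in>Pow {1..n}. card I = k} = n choose k"
        using n_subsets[of "{1..n}" k] by simp
      then have "(\<Sum>I\<in>{I\<in>Pow {1..n}. card I = k}. ?f I) =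
          real (n choose k) * (inverse ((exp 1 * real n / real k) ^ k) * ?q ^ k)"
        using eq by simp
      also have "\<dots> \<le> (exp 1 * real n / real k) ^ k * (inverse ((exp 1 * real n / real k) ^ k) * ?q ^ k)"
        using binomial_le_exp_power[of k n] False \<open>k \<in> {..n}\<close>
        by (intro mult_right_mono) auto
      also have "\<dots> = ?q ^ k" using False \<open>k \<in> {..n}\<close> by simp
      finally show ?thesis .
    qed
  qed
  also have "\<dots> \<le> (\<Sum>k. ?q ^ k)"
    by (intro sum_le_suminf summable_geometric) auto
  also have "\<dots> = sparsity_const" by (subst suminf_geometric) (auto simp: sparsity_const_def)
  finally show ?thesis .
qed

section \<open>The posterior as a Gibbs measure\<close>

lemma prior_weight_eq:
  assumes "I \<subseteq> {1..n}"
  shows "prior_weight \<kappa> n I = exp (- \<kappa> * model_complexity n I)"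
proof (cases "I = {}")
  case False
  have "finite I" using assms finite_subset by blast
  then have c: "card I > 0" using False by (simp add: card_gt_0_iff)
  moreover have "card I \<le> n" using card_mono[OF _ assms(1)] by simp
  ultimately show ?thesis using False by (auto simp: prior_weight_def model_complexity_def powr_def)
qed (simp add: prior_weight_def model_complexity_def)

text \<open>Moves sums over different complements to one index range, so that they can be combined
  term by term.\<close>

lemma sum_diff_if:
  "(\<Sum>i\<in>{1..n::nat} - I. f i) = (\<Sum>i\<in>{1..n}. if i \<in> I then 0 else f i :: real)"
  by (rule sum.mono_neutral_cong_left) auto

text \<open>On I each density is evaluated at its own mean, and its variance is \<sigma>^2 e n /
  |I|; this gives a factor exp(-l/2) per coordinate, hence the complexity in the exponent. Off I the
  density is that of N(0, \<sigma>^2).\<close>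

lemma marginal_eq:
  assumes "I \<subseteq> {1..n}" "\<sigma> > 0"
  shows "marginal n \<sigma> x I = (1 / sqrt (2 * pi * \<sigma>\<^sup>2)) ^ n *
     exp (- ((\<Sum>i\<in>{1..n} - I. (x i)\<^sup>2) + \<sigma>\<^sup>2 * model_complexity n I) / (2 * \<sigma>\<^sup>2))"
proof -
  have fin: "finite I" using assms finite_subset by blast
  define l where "l = ln (exp 1 * real n / real (card I))"
  have "normal_density (x i * indicator I i) (sqrt (\<sigma>\<^sup>2 + tau2 n \<sigma> I i)) (x i) =
     1 / sqrt (2 * pi * \<sigma>\<^sup>2) * exp (- ((if i \<in> I then 0 else (x i)\<^sup>2) + (if i \<in> I then \<sigma>\<^sup>2 * l else 0)) / (2 * \<sigma>\<^sup>2))"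
    if "i \<in> {1..n}" for i
  proof (cases "i \<in> I")
    case True
    then have c: "card I > 0" using fin by (auto simp: card_gt_0_iff)
    have n: "n > 0" using that by auto
    have *: "\<sigma>\<^sup>2 + tau2 n \<sigma> I i = \<sigma>\<^sup>2 * (exp 1 * real n / real (card I))"
      using True by (auto simp: tau2_def Kn_def algebra_simps)
    have l: "exp 1 * real n / real (card I) = exp (l / 2) ^ 2"
      using c n by (simp add: l_def power2_eq_square flip: exp_add)
    show ?thesis using True assms(2)
      unfolding normal_density_def * l by (simp add: real_sqrt_mult exp_minus field_simps)
  next
    case False
    then show ?thesis using assms(2) by (simp add: tau2_def normal_density_def)
  qed
  then have "marginal n \<sigma> x I = (\<Prod>i\<in>{1..n}. 1 / sqrt (2 * pi * \<sigma>\<^sup>2) *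
      exp (- ((if i \<in> I then 0 else (x i)\<^sup>2) + (if i \<in> I then \<sigma>\<^sup>2 * l else 0)) / (2 * \<sigma>\<^sup>2)))"
    unfolding marginal_def by (intro prod.cong) auto
  also have "\<dots> = (1 / sqrt (2 * pi * \<sigma>\<^sup>2)) ^ n *
      exp (\<Sum>i\<in>{1..n}. - ((if i \<in> I then 0 else (x i)\<^sup>2) + (if i \<in> I then \<sigma>\<^sup>2 * l else 0)) / (2 * \<sigma>\<^sup>2))"
    unfolding prod.distrib by (simp add: exp_sum)
  also have "(\<Sum>i\<in>{1..n}. - ((if i \<in> I then 0 else (x i)\<^sup>2) + (if i \<in> I then \<sigma>\<^sup>2 * l else 0)) / (2 * \<sigma>\<^sup>2)) =
      - ((\<Sum>i\<in>{1..n}. if i \<in> I then 0 else (x i)\<^sup>2) + (\<Sum>i\<in>{1..n}. if i \<in> I then \<sigma>\<^sup>2 * l else 0)) / (2 * \<sigma>\<^sup>2)"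
    by (simp only: sum_divide_distrib[symmetric] sum_negf sum.distrib)
  also have "(\<Sum>i\<in>{1..n}. if i \<in> I then \<sigma>\<^sup>2 * l else 0) = \<sigma>\<^sup>2 * model_complexity n I"
    using assms by (simp add: sum.If_cases Int_absorb1 model_complexity_def l_def)
  finally show ?thesis by (simp only: sum_diff_if)
qed

lemma posterior_eq:
  assumes "I \<subseteq> {1..n}" "\<sigma> > 0"
  shows "posterior \<kappa> n \<sigma> x I = exp (- crit \<kappa> n \<sigma> x I / (2 * \<sigma>\<^sup>2)) /
    (\<Sum>J\<in>Pow {1..n}. exp (- crit \<kappa> n \<sigma> x J / (2 * \<sigma>\<^sup>2)))"
proof -
  \<comment> \<open>\<open>Z\<close> collects all factors that do not depend on the index set,
    including the normalization of the prior; it cancels in the posterior ratio.\<close>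
  define Z where "Z = (1 / sqrt (2 * pi * \<sigma>\<^sup>2)) ^ n / (\<Sum>J\<in>Pow {1..n}. prior_weight \<kappa> n J)"
  have "(\<Sum>J\<in>Pow {1..n}. prior_weight \<kappa> n J) = (\<Sum>J\<in>Pow {1..n}. exp (- \<kappa> * model_complexity n J))"
    by (intro sum.cong) (auto simp: prior_weight_eq)
  also have "\<dots> > 0" by (intro sum_pos) auto
  finally have Z: "Z > 0" using assms by (simp add: Z_def)
  have *: "prior \<kappa> n J * marginal n \<sigma> x J = Z * exp (- crit \<kappa> n \<sigma> x J / (2 * \<sigma>\<^sup>2))"
    if "J \<subseteq> {1..n}" for J
  proof -
    have "prior \<kappa> n J * marginal n \<sigma> x J = Z * (exp (- \<kappa> * model_complexity n J) *
       exp (- ((\<Sum>i\<in>{1..n} - J. (x i)\<^sup>2) + \<sigma>\<^sup>2 * model_complexity n J) / (2 * \<sigma>\<^sup>2)))"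
      unfolding prior_def Z_def prior_weight_eq[OF that] marginal_eq[OF that assms(2)] by simp
    also have "exp (- \<kappa> * model_complexity n J) *
       exp (- ((\<Sum>i\<in>{1..n} - J. (x i)\<^sup>2) + \<sigma>\<^sup>2 * model_complexity n J) / (2 * \<sigma>\<^sup>2)) =
        exp (- crit \<kappa> n \<sigma> x J / (2 * \<sigma>\<^sup>2))"
      unfolding exp_add[symmetric] crit_def using assms(2) by (simp add: field_simps)
    finally show ?thesis .
  qed
  have "(\<Sum>J\<in>Pow {1..n}. prior \<kappa> n J * marginal n \<sigma> x J) =
      Z * (\<Sum>J\<in>Pow {1..n}. exp (- crit \<kappa> n \<sigma> x J / (2 * \<sigma>\<^sup>2)))"
    unfolding sum_distrib_left by (intro sum.cong) (auto simp: *)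
  then show ?thesis using Z by (simp add: posterior_def *[OF assms(1)])
qed

lemma sum_exp_crit_pos: "0 < (\<Sum>J\<in>Pow {1..n}. exp (- crit \<kappa> n \<sigma> x J / (2 * \<sigma>\<^sup>2)))"
  by (intro sum_pos) auto

lemma posterior_nonneg: "I \<subseteq> {1..n} \<Longrightarrow> \<sigma> > 0 \<Longrightarrow> 0 \<le> posterior \<kappa> n \<sigma> x I"
  using sum_exp_crit_pos[of \<kappa> n \<sigma> x] by (simp add: posterior_eq)

lemma sum_posterior: "\<sigma> > 0 \<Longrightarrow> (\<Sum>I\<in>Pow {1..n}. posterior \<kappa> n \<sigma> x I) = 1"
  using sum_exp_crit_pos[of \<kappa> n \<sigma> x] by (simp add: posterior_eq sum_divide_distrib[symmetric])

text \<open>Only the term of \<open>J\<close> is kept in the normalizing sum.\<close>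

lemma posterior_le:
  assumes "I \<subseteq> {1..n}" "J \<subseteq> {1..n}" "\<sigma> > 0"
  shows "posterior \<kappa> n \<sigma> x I \<le> exp (- (crit \<kappa> n \<sigma> x I - crit \<kappa> n \<sigma> x J) / (2 * \<sigma>\<^sup>2))"
proof -
  let ?e = "\<lambda>J. exp (- crit \<kappa> n \<sigma> x J / (2 * \<sigma>\<^sup>2))"
  have "?e J \<le> sum ?e (Pow {1..n})" using assms by (intro member_le_sum) auto
  then have "posterior \<kappa> n \<sigma> x I \<le> ?e I / ?e J"
    unfolding posterior_eq[OF assms(1,3)] by (intro divide_left_mono mult_pos_pos sum_exp_crit_pos) auto
  then show ?thesis by (simp add: exp_diff[symmetric] diff_divide_distrib)
qed

lemma crit_le_of_posterior_ge:
  assumes "I \<subseteq> {1..n}" "J \<subseteq> {1..n}" "\<sigma> > 0" "posterior \<kappa> n \<sigma> x J \<le> posterior \<kappa> n \<sigma> x I"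
  shows "crit \<kappa> n \<sigma> x I \<le> crit \<kappa> n \<sigma> x J"
  using assms sum_exp_crit_pos[of \<kappa> n \<sigma> x] by (simp add: posterior_eq divide_le_cancel)

section \<open>Oracle inequality on the event of small noise\<close>

text \<open>Phrased through the observation and the parameter, so that it defines an event in the
  sample space. In the coefficient 2 + B, the B compensates the moment bound exp(B |J|), and the two
  extra units of complexity pay for the number of sets and for summability over sizes.\<close>

definition small_noise :: "nat \<Rightarrow> real \<Rightarrow> real \<Rightarrow> real \<Rightarrow> real \<Rightarrow> vec \<Rightarrow> vec \<Rightarrow> bool" where
  "small_noise n \<sigma> \<beta> B M \<theta> x \<longleftrightarrow>
     (\<forall>J\<subseteq>{1..n}. (\<Sum>i\<in>J. (x i - \<theta> i)\<^sup>2) \<le> \<sigma>\<^sup>2 * ((2 + B) * model_complexity n J + M) / \<beta>)"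

text \<open>Equals (2 \<kappa> + 1) + (2 + B)/\<beta> + 3/\<beta>: the first two summands bound the
  cost of the complexity of the comparison set, the third that of the noise level \<open>M\<close>,
  which enters once through \<open>J\<close> and twice through \<open>I\<close>.\<close>

definition crit_const :: "real \<Rightarrow> real \<Rightarrow> real \<Rightarrow> real" where
  "crit_const \<beta> B \<kappa> = 2 * \<kappa> + 1 + (5 + B) / \<beta>"

text \<open>Squares of observations are compared with squares of the parameter coordinate by
  coordinate, at the price of noise on \<open>J\<close> once and on \<open>I\<close> twice. The
  noise on \<open>I\<close> is paid for by the penalty in \<open>crit\<close>, while everything
  belonging to \<open>J\<close> goes into the oracle term.\<close>

lemma crit_diff_ge:
  assumes \<beta>: "0 < \<beta>" "\<beta> \<le> 1" "0 < B" and \<kappa>: "1 < \<kappa>" "\<kappa> > (12 - \<beta> + 4 * B) / (4 * \<beta>)"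
    and sub: "I \<subseteq> {1..n}" "J \<subseteq> {1..n}" and M: "0 \<le> M" and sn: "small_noise n \<sigma> \<beta> B M \<theta> x"
  shows "crit \<kappa> n \<sigma> x I - crit \<kappa> n \<sigma> x J \<ge>
    (\<Sum>i\<in>{1..n} - I. (\<theta> i)\<^sup>2) / 2 + 5 / 2 * \<sigma>\<^sup>2 * model_complexity n I
      - crit_const \<beta> B \<kappa> * (oracle_term n \<sigma> \<theta> J + \<sigma>\<^sup>2 * M)"
proof -
  let ?r = "model_complexity n" and ?e = "\<lambda>i. (x i - \<theta> i)\<^sup>2"
  let ?t = "\<lambda>I. \<Sum>i\<in>{1..n} - I. (\<theta> i)\<^sup>2"
  define A where "A = (2 + B) / \<beta>"
  define K where "K = crit_const \<beta> B \<kappa>"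
  have sum_in: "(\<Sum>i\<in>L. f i) = (\<Sum>i\<in>{1..n}. if i \<in> L then f i else 0 :: real)" if "L \<subseteq> {1..n}" for L f
    using that by (intro sum.mono_neutral_cong_left) auto
  have ptw: "(if i \<in> I then 0 else (\<theta> i)\<^sup>2) / 2 - 5 / 2 * (if i \<in> J then 0 else (\<theta> i)\<^sup>2)
      - (if i \<in> J then ?e i else 0) - 2 * (if i \<in> I then ?e i else 0)
      \<le> (if i \<in> I then 0 else (x i)\<^sup>2) - (if i \<in> J then 0 else (x i)\<^sup>2)" for i
  proof -
    \<comment> \<open>The first square settles coordinates in I but not J, the second those in J but
      not I; in the other two cases the observations cancel or vanish.\<close>
    have "0 \<le> (x i - 2 * \<theta> i)\<^sup>2 + (\<theta> i)\<^sup>2 / 2" "0 \<le> (2 * x i - \<theta> i)\<^sup>2" "0 \<le> (\<theta> i)\<^sup>2" "0 \<le> ?e i"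
      by simp_all
    then show ?thesis by (auto simp: power2_eq_square algebra_simps)
  qed
  have "(\<Sum>i\<in>{1..n}. (if i \<in> I then 0 else (\<theta> i)\<^sup>2) / 2 - 5 / 2 * (if i \<in> J then 0 else (\<theta> i)\<^sup>2)
      - (if i \<in> J then ?e i else 0) - 2 * (if i \<in> I then ?e i else 0))
      \<le> (\<Sum>i\<in>{1..n}. (if i \<in> I then 0 else (x i)\<^sup>2) - (if i \<in> J then 0 else (x i)\<^sup>2))"
    by (intro sum_mono ptw)
  then have 1: "?t I / 2 - 5 / 2 * ?t J - sum ?e J - 2 * sum ?e I
      \<le> (\<Sum>i\<in>{1..n} - I. (x i)\<^sup>2) - (\<Sum>i\<in>{1..n} - J. (x i)\<^sup>2)"
    unfolding sum_diff_if sum_in[OF sub(1)] sum_in[OF sub(2)]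
    by (simp only: sum_subtractf sum_divide_distrib sum_distrib_left)
  have e: "sum ?e L \<le> A * (\<sigma>\<^sup>2 * ?r L) + \<sigma>\<^sup>2 * M / \<beta>" if "L \<subseteq> {1..n}" for L
    using sn[unfolded small_noise_def, rule_format, OF that] by (simp add: A_def algebra_simps add_divide_distrib)
  \<comment> \<open>The lower bound on \<kappa> is spent here: the penalty covers twice the noise
    coefficient and leaves 5/2. Since \<beta> <= 1, one has 12 - \<beta> >= 8 + 3 \<beta>, which is
    the amount required.\<close>
  have q: "2 * A + 5 / 2 \<le> 2 * \<kappa> + 1"
  proof -
    have "12 - \<beta> + 4 * B < 4 * \<beta> * \<kappa>" using \<kappa>(2) \<beta> by (simp add: field_simps)
    then have "2 * (2 + B) + 5 / 2 * \<beta> \<le> (2 * \<kappa> + 1) * \<beta>" using \<beta> by (simp add: algebra_simps)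
    then show ?thesis using \<beta> by (simp add: A_def field_simps)
  qed
  have K: "K = 2 * \<kappa> + 1 + A + 3 / \<beta>" using \<beta> by (simp add: K_def crit_const_def A_def field_simps)
  have pos: "0 \<le> \<sigma>\<^sup>2 * ?r I" "0 \<le> \<sigma>\<^sup>2 * ?r J" "0 \<le> ?t J" "0 \<le> \<sigma>\<^sup>2 * M" "A \<ge> 0" "3 / \<beta> \<ge> 0"
    using model_complexity_nonneg sub M \<beta> by (auto simp: sum_nonneg A_def)
  have Kge: "5 / 2 \<le> K" "2 * \<kappa> + 1 + A \<le> K" "3 / \<beta> \<le> K"
    using q pos(5,6) \<kappa>(1) unfolding K by linarith+
  have "(2 * A + 5 / 2) * (\<sigma>\<^sup>2 * ?r I) \<le> (2 * \<kappa> + 1) * (\<sigma>\<^sup>2 * ?r I)"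
    by (intro mult_right_mono q pos)
  moreover have "5 / 2 * ?t J \<le> K * ?t J"
    by (intro mult_right_mono Kge pos)
  moreover have "(2 * \<kappa> + 1 + A) * (\<sigma>\<^sup>2 * ?r J) \<le> K * (\<sigma>\<^sup>2 * ?r J)"
    by (intro mult_right_mono Kge pos)
  moreover have "3 * (\<sigma>\<^sup>2 * M / \<beta>) \<le> K * (\<sigma>\<^sup>2 * M)"
  proof -
    have "3 / \<beta> * (\<sigma>\<^sup>2 * M) \<le> K * (\<sigma>\<^sup>2 * M)"
      by (intro mult_right_mono Kge pos)
    then show ?thesis by simp
  qed
  ultimately show ?thesis using 1 e[OF sub(1)] e[OF sub(2)]
    unfolding crit_def oracle_term_def K_def[symmetric] by (simp add: algebra_simps)
qed

section \<open>Squared losses of restricted observations and of their posterior mean\<close>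

lemma vnorm_sq: "(vnorm n v)\<^sup>2 = (\<Sum>i\<in>{1..n}. (v i)\<^sup>2)"
  unfolding vnorm_def L2_set_def by (simp add: sum_nonneg)

lemma vnorm_restr_sq:
  assumes "I \<subseteq> {1..n}"
  shows "(vnorm n (\<lambda>i. restr n x I i - \<theta> i))\<^sup>2 = (\<Sum>i\<in>I. (x i - \<theta> i)\<^sup>2) + (\<Sum>i\<in>{1..n} - I. (\<theta> i)\<^sup>2)"
proof -
  have fin: "finite I" using assms finite_subset by blast
  have "(vnorm n (\<lambda>i. restr n x I i - \<theta> i))\<^sup>2 = (\<Sum>i\<in>{1..n}. if i \<in> I then (x i - \<theta> i)\<^sup>2 else (\<theta> i)\<^sup>2)"
    unfolding vnorm_sq by (intro sum.cong) (auto simp: restr_def)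
  also have "\<dots> = (\<Sum>i\<in>I. (x i - \<theta> i)\<^sup>2) + (\<Sum>i\<in>{1..n} - I. (\<theta> i)\<^sup>2)"
    using assms fin by (simp add: sum.If_cases Int_absorb1 Diff_eq Collect_neg_eq)
  finally show ?thesis .
qed

lemma vnorm_restr_le:
  assumes \<beta>: "0 < \<beta>" "\<beta> \<le> 1" "0 < B" and I: "I \<subseteq> {1..n}"
    and sn: "small_noise n \<sigma> \<beta> B M \<theta> x"
  shows "(vnorm n (\<lambda>i. restr n x I i - \<theta> i))\<^sup>2 \<le> (2 + B) / \<beta> * oracle_term n \<sigma> \<theta> I + \<sigma>\<^sup>2 * M / \<beta>"
proof -
  have A: "1 \<le> (2 + B) / \<beta>" using \<beta> by (simp add: field_simps)
  \<comment> \<open>The coefficient 1 of the bias is enlarged to that of the complexity, so that the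
    two combine into one multiple of the oracle term.\<close>
  have "1 * (\<Sum>i\<in>{1..n} - I. (\<theta> i)\<^sup>2) \<le> (2 + B) / \<beta> * (\<Sum>i\<in>{1..n} - I. (\<theta> i)\<^sup>2)"
    by (intro mult_right_mono A) (auto simp: sum_nonneg)
  then show ?thesis
    using sn[unfolded small_noise_def, rule_format, OF I] \<beta> unfolding vnorm_restr_sq[OF I] oracle_term_def
    by (simp add: field_simps)
qed

text \<open>Jensen's inequality for the square: the weighted variance about the mean
  \<open>m\<close> is nonnegative.\<close>

lemma weighted_mean_square_le:
  fixes w a :: "'a \<Rightarrow> real"
  assumes "\<And>i. i \<in> A \<Longrightarrow> 0 \<le> w i" "sum w A = 1"
  shows "(\<Sum>i\<in>A. w i * a i)\<^sup>2 \<le> (\<Sum>i\<in>A. w i * (a i)\<^sup>2)"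
proof -
  define m where "m = (\<Sum>i\<in>A. w i * a i)"
  have "0 \<le> (\<Sum>i\<in>A. w i * (a i - m)\<^sup>2)" by (intro sum_nonneg mult_nonneg_nonneg assms) auto
  also have "\<dots> = (\<Sum>i\<in>A. w i * (a i)\<^sup>2 - 2 * m * (w i * a i) + m\<^sup>2 * w i)"
    by (intro sum.cong) (auto simp: power2_eq_square algebra_simps)
  also have "\<dots> = (\<Sum>i\<in>A. w i * (a i)\<^sup>2) - 2 * m * m + m\<^sup>2 * 1"
    unfolding sum.distrib sum_subtractf sum_distrib_left[symmetric] assms(2) m_def ..
  finally show ?thesis by (simp add: m_def power2_eq_square)
qed

text \<open>As the posterior weights sum to 1, the error of the posterior mean is the weighted mean
  of the errors of the restrictions, and Jensen's inequality applies in each coordinate.\<close>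

lemma vnorm_theta_tilde_le:
  assumes "\<sigma> > 0"
  shows "(vnorm n (\<lambda>i. theta_tilde \<kappa> n \<sigma> x i - \<theta> i))\<^sup>2 \<le>
    (\<Sum>I\<in>Pow {1..n}. posterior \<kappa> n \<sigma> x I * (vnorm n (\<lambda>i. restr n x I i - \<theta> i))\<^sup>2)"
proof -
  let ?p = "posterior \<kappa> n \<sigma> x"
  have "theta_tilde \<kappa> n \<sigma> x i - \<theta> i = (\<Sum>I\<in>Pow {1..n}. ?p I * (restr n x I i - \<theta> i))"
    if "i \<in> {1..n}" for i
  proof -
    have "(\<Sum>I\<in>Pow {1..n}. ?p I * (restr n x I i - \<theta> i)) =
        (\<Sum>I\<in>Pow {1..n}. restr n x I i * ?p I) - \<theta> i * (\<Sum>I\<in>Pow {1..n}. ?p I)"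
      unfolding sum_distrib_left sum_subtractf[symmetric] by (intro sum.cong) (auto simp: algebra_simps)
    then show ?thesis using that by (simp add: theta_tilde_def sum_posterior[OF assms, unfolded One_nat_def])
  qed
  then have "(vnorm n (\<lambda>i. theta_tilde \<kappa> n \<sigma> x i - \<theta> i))\<^sup>2 =
     (\<Sum>i\<in>{1..n}. (\<Sum>I\<in>Pow {1..n}. ?p I * (restr n x I i - \<theta> i))\<^sup>2)"
    unfolding vnorm_sq by (intro sum.cong) auto
  also have "\<dots> \<le> (\<Sum>i\<in>{1..n}. \<Sum>I\<in>Pow {1..n}. ?p I * (restr n x I i - \<theta> i)\<^sup>2)"
    by (intro sum_mono weighted_mean_square_le sum_posterior posterior_nonneg assms) auto
  also have "\<dots> = (\<Sum>I\<in>Pow {1..n}. ?p I * (vnorm n (\<lambda>i. restr n x I i - \<theta> i))\<^sup>2)"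
    unfolding vnorm_sq sum_distrib_left by (rule sum.swap)
  finally show ?thesis .
qed

section \<open>Elementary properties of the oracle rate\<close>

lemma oracle_term_nonneg: "I \<subseteq> {1..n} \<Longrightarrow> 0 \<le> oracle_term n \<sigma> \<theta> I"
  using model_complexity_nonneg[of I n] by (auto simp: oracle_term_def sum_nonneg)

lemma oracle_rate2_eq: "oracle_rate2 n \<sigma> \<theta> = (MIN I\<in>Pow {1..n}. oracle_term n \<sigma> \<theta> I)"
  by (simp add: oracle_rate2_def oracle_term_def model_complexity_def mult.assoc)

lemma oracle_rate2_attained:
  obtains J where "J \<subseteq> {1..n}" "oracle_rate2 n \<sigma> \<theta> = oracle_term n \<sigma> \<theta> J"
proof -
  have "Min (oracle_term n \<sigma> \<theta> ` Pow {1..n}) \<in> oracle_term n \<sigma> \<theta> ` Pow {1..n}"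
    by (intro Min_in) auto
  then show ?thesis using that unfolding oracle_rate2_eq by auto
qed

lemma oracle_rate2_nonneg: "0 \<le> oracle_rate2 n \<sigma> \<theta>"
  by (metis oracle_rate2_attained oracle_term_nonneg)

text \<open>The full index set has no bias, and its logarithm is log e = 1.\<close>

lemma oracle_rate2_le: "oracle_rate2 n \<sigma> \<theta> \<le> real n * \<sigma>\<^sup>2"
proof -
  have "oracle_rate2 n \<sigma> \<theta> \<le> oracle_term n \<sigma> \<theta> {1..n}"
    unfolding oracle_rate2_eq by (intro Min_le) auto
  also have "\<dots> = real n * \<sigma>\<^sup>2" by (simp add: oracle_term_def model_complexity_def)
  finally show ?thesis .
qed

text \<open>The factor 8 \<open>crit_const\<close> is the threshold beyond which the posterior of a
  set decays, (2 + B)/\<beta> converts oracle terms into losses, and 1/\<beta> comes from the noise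
  level in the loss of a fixed set. The offset below is the total contribution of the sets beyond
  the threshold.\<close>

definition loss_slope :: "real \<Rightarrow> real \<Rightarrow> real \<Rightarrow> real" where
  "loss_slope \<beta> B \<kappa> = 8 * ((2 + B) / \<beta>) * crit_const \<beta> B \<kappa> + 1 / \<beta>"

definition loss_offset :: "real \<Rightarrow> real \<Rightarrow> real" where
  "loss_offset \<beta> B = 16 * ((2 + B) / \<beta>) * sparsity_const"

lemma mult_exp_neg_le: "0 < s \<Longrightarrow> x * exp (- x / s) \<le> (s :: real)"
proof -
  assume s: "0 < s"
  have "x / s \<le> exp (x / s)" using exp_ge_add_one_self[of "x / s"] by linarith
  then show ?thesis using s by (simp add: exp_minus field_simps)
qed

text \<open>Sets with oracle term at most \<open>T\<close> are charged to their posterior mass.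
  Beyond \<open>T\<close> the posterior decays exponentially in the oracle term, which absorbs the
  factor \<open>oracle_term\<close> and leaves a weight summable over all sets.\<close>

lemma posterior_oracle_term_le:
  assumes \<beta>: "0 < \<beta>" "\<beta> \<le> 1" "0 < B" and \<kappa>: "1 < \<kappa>" "\<kappa> > (12 - \<beta> + 4 * B) / (4 * \<beta>)"
    and \<sigma>: "\<sigma> > 0" and sub: "I \<subseteq> {1..n}" and M: "0 \<le> M" and sn: "small_noise n \<sigma> \<beta> B M \<theta> x"
  defines "T \<equiv> 8 * crit_const \<beta> B \<kappa> * (oracle_rate2 n \<sigma> \<theta> + \<sigma>\<^sup>2 * M)"
  shows "posterior \<kappa> n \<sigma> x I * oracle_term n \<sigma> \<theta> I \<le>
    T * posterior \<kappa> n \<sigma> x I + 16 * \<sigma>\<^sup>2 * exp (- model_complexity n I - real (card I) / 8)"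
proof -
  let ?p = "posterior \<kappa> n \<sigma> x I" and ?L = "oracle_term n \<sigma> \<theta> I" and ?r = "model_complexity n I"
  let ?w = "exp (- ?r - real (card I) / 8)"
  have p: "0 \<le> ?p" by (intro posterior_nonneg sub \<sigma>)
  show ?thesis
  proof (cases "?L \<le> T")
    case True
    then have "?p * ?L \<le> T * ?p" using p by (metis mult.commute mult_left_mono)
    moreover have "0 \<le> 16 * \<sigma>\<^sup>2 * ?w" by simp
    ultimately show ?thesis by linarith
  next
    case False
    obtain J where J: "J \<subseteq> {1..n}" "oracle_rate2 n \<sigma> \<theta> = oracle_term n \<sigma> \<theta> J"
      by (rule oracle_rate2_attained)
    have cd: "(\<Sum>i\<in>{1..n} - I. (\<theta> i)\<^sup>2) / 2 + 5 / 2 * \<sigma>\<^sup>2 * ?r - T / 8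
        \<le> crit \<kappa> n \<sigma> x I - crit \<kappa> n \<sigma> x J"
      using crit_diff_ge[OF \<beta> \<kappa> sub J(1) M sn] by (simp add: T_def J(2))
    have t: "0 \<le> (\<Sum>i\<in>{1..n} - I. (\<theta> i)\<^sup>2)" by (simp add: sum_nonneg)
    have "\<sigma>\<^sup>2 * real (card I) \<le> \<sigma>\<^sup>2 * ?r"
      by (intro mult_left_mono card_le_model_complexity sub) auto
    \<comment> \<open>The coefficient 5/2 of the complexity is split as 1/4 + 2 + 1/4: for a quarter
      of the oracle term, for the number of sets, and for the term in |I|.\<close>
    then have "?L / 4 + 2 * (\<sigma>\<^sup>2 * ?r) + \<sigma>\<^sup>2 * real (card I) / 4
        \<le> crit \<kappa> n \<sigma> x I - crit \<kappa> n \<sigma> x J + T / 8"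
      using cd t unfolding oracle_term_def by argo
    then have "- (crit \<kappa> n \<sigma> x I - crit \<kappa> n \<sigma> x J) / (2 * \<sigma>\<^sup>2)
       \<le> (T / 8 - (?L / 4 + 2 * (\<sigma>\<^sup>2 * ?r) + \<sigma>\<^sup>2 * real (card I) / 4)) / (2 * \<sigma>\<^sup>2)"
      by (intro divide_right_mono) auto
    \<comment> \<open>The oracle term is halved: one half outweighs the \<open>T\<close> term
      because \<open>?L\<close> exceeds \<open>T\<close>, the other is kept to absorb the factor
      \<open>?L\<close>.\<close>
    also have "\<dots> = - ?L / (16 * \<sigma>\<^sup>2) + (- ?L / (16 * \<sigma>\<^sup>2) + T / (16 * \<sigma>\<^sup>2)) + (- ?r - real (card I) / 8)"
      using \<sigma> by (simp add: field_simps)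
    also have "\<dots> \<le> - ?L / (16 * \<sigma>\<^sup>2) + (- ?r - real (card I) / 8)"
      using False \<sigma> by (simp add: field_simps)
    finally have "?p \<le> exp (- ?L / (16 * \<sigma>\<^sup>2)) * ?w"
      using posterior_le[OF sub J(1) \<sigma>, of \<kappa> x] unfolding exp_add[symmetric]
      by (meson exp_le_cancel_iff order_trans)
    then have "?p * ?L \<le> (exp (- ?L / (16 * \<sigma>\<^sup>2)) * ?w) * ?L"
      using oracle_term_nonneg[OF sub] by (rule mult_right_mono)
    also have "\<dots> = (?L * exp (- ?L / (16 * \<sigma>\<^sup>2))) * ?w" by simp
    also have "\<dots> \<le> 16 * \<sigma>\<^sup>2 * ?w"
      using mult_exp_neg_le[of "16 * \<sigma>\<^sup>2" ?L] \<sigma> by (intro mult_right_mono) auto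
    also have "\<dots> \<le> T * ?p + 16 * \<sigma>\<^sup>2 * ?w"
    proof -
      have "0 \<le> T" using \<beta> \<kappa>(1) M oracle_rate2_nonneg[of n \<sigma> \<theta>] by (simp add: T_def crit_const_def)
      then show ?thesis using p by simp
    qed
    finally show ?thesis .
  qed
qed

lemma crit_const_pos: "0 < \<beta> \<Longrightarrow> 0 < B \<Longrightarrow> 1 < \<kappa> \<Longrightarrow> 0 < crit_const \<beta> B \<kappa>"
  by (simp add: crit_const_def add_pos_pos)

lemma loss_bound:
  assumes \<beta>: "0 < \<beta>" "\<beta> \<le> 1" "0 < B" and \<kappa>: "1 < \<kappa>" "\<kappa> > (12 - \<beta> + 4 * B) / (4 * \<beta>)"
    and \<sigma>: "\<sigma> > 0" and M: "0 \<le> M" and sn: "small_noise n \<sigma> \<beta> B M \<theta> x"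
    and x: "x \<in> space (Rn n)"
    and est: "\<theta>hat = theta_tilde \<kappa> n \<sigma> \<or>
         (\<exists>Ihat. posterior_mode \<kappa> n \<sigma> Ihat \<and> \<theta>hat = theta_check n Ihat)"
  shows "(vnorm n (\<lambda>i. \<theta>hat x i - \<theta> i))\<^sup>2 \<le>
    loss_slope \<beta> B \<kappa> * oracle_rate2 n \<sigma> \<theta> + \<sigma>\<^sup>2 * (loss_slope \<beta> B \<kappa> * M + loss_offset \<beta> B)"
proof -
  define A where "A = (2 + B) / \<beta>"
  define K where "K = crit_const \<beta> B \<kappa>"
  define r2 where "r2 = oracle_rate2 n \<sigma> \<theta>"
  define T where "T = 8 * K * (r2 + \<sigma>\<^sup>2 * M)"
  have r2: "0 \<le> r2" by (simp add: r2_def oracle_rate2_nonneg)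
  have A: "0 < A" using \<beta> by (simp add: A_def)
  have K: "0 < K" unfolding K_def by (rule crit_const_pos[OF \<beta>(1,3) \<kappa>(1)])
  have S: "0 < sparsity_const" using sparsity_const_ge_1 by linarith
  have T: "0 \<le> T" using K r2 M by (simp add: T_def)
  \<comment> \<open>One bound serves both estimators; for the posterior mode the summand with
    \<open>sparsity_const\<close> is slack.\<close>
  have "(vnorm n (\<lambda>i. \<theta>hat x i - \<theta> i))\<^sup>2 \<le> A * (T + 16 * \<sigma>\<^sup>2 * sparsity_const) + \<sigma>\<^sup>2 * M / \<beta>"
    using est
  proof (elim disjE exE conjE)
    assume th: "\<theta>hat = theta_tilde \<kappa> n \<sigma>"
    let ?p = "posterior \<kappa> n \<sigma> x"
    have "(\<Sum>I\<in>Pow {1..n}. ?p I * oracle_term n \<sigma> \<theta> I)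
       \<le> (\<Sum>I\<in>Pow {1..n}. T * ?p I + 16 * \<sigma>\<^sup>2 * exp (- model_complexity n I - real (card I) / 8))"
      unfolding T_def K_def r2_def by (intro sum_mono posterior_oracle_term_le \<beta> \<kappa> \<sigma> M sn) auto
    also have "\<dots> = T + 16 * \<sigma>\<^sup>2 * (\<Sum>I\<in>Pow {1..n}. exp (- model_complexity n I - real (card I) / 8))"
      by (simp only: sum.distrib sum_distrib_left[symmetric] sum_posterior[OF \<sigma>] mult_1_right)
    also have "\<dots> \<le> T + 16 * \<sigma>\<^sup>2 * sparsity_const"
      by (intro add_left_mono mult_left_mono sum_exp_model_complexity) auto
    finally have 1: "(\<Sum>I\<in>Pow {1..n}. ?p I * oracle_term n \<sigma> \<theta> I) \<le> T + 16 * \<sigma>\<^sup>2 * sparsity_const" .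
    have "(vnorm n (\<lambda>i. \<theta>hat x i - \<theta> i))\<^sup>2 \<le>
        (\<Sum>I\<in>Pow {1..n}. ?p I * (vnorm n (\<lambda>i. restr n x I i - \<theta> i))\<^sup>2)"
      unfolding th by (rule vnorm_theta_tilde_le[OF \<sigma>])
    also have "\<dots> \<le> (\<Sum>I\<in>Pow {1..n}. ?p I * (A * oracle_term n \<sigma> \<theta> I + \<sigma>\<^sup>2 * M / \<beta>))"
      unfolding A_def by (intro sum_mono mult_left_mono vnorm_restr_le \<beta> sn posterior_nonneg \<sigma>) auto
    also have "\<dots> = (\<Sum>I\<in>Pow {1..n}. A * (?p I * oracle_term n \<sigma> \<theta> I) + (\<sigma>\<^sup>2 * M / \<beta>) * ?p I)"
      by (intro sum.cong) (simp_all only: algebra_simps)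
    also have "\<dots> = A * (\<Sum>I\<in>Pow {1..n}. ?p I * oracle_term n \<sigma> \<theta> I) + (\<sigma>\<^sup>2 * M / \<beta>) * 1"
      by (simp only: sum.distrib sum_distrib_left[symmetric] sum_posterior[OF \<sigma>])
    also have "\<dots> \<le> A * (T + 16 * \<sigma>\<^sup>2 * sparsity_const) + \<sigma>\<^sup>2 * M / \<beta>"
      using 1 A by simp
    finally show ?thesis .
  next
    fix Ihat assume mode: "posterior_mode \<kappa> n \<sigma> Ihat" and th: "\<theta>hat = theta_check n Ihat"
    obtain J where J: "J \<subseteq> {1..n}" "oracle_rate2 n \<sigma> \<theta> = oracle_term n \<sigma> \<theta> J"
      by (rule oracle_rate2_attained)
    have am: "is_arg_max (posterior \<kappa> n \<sigma> x) (\<lambda>I. I \<in> Pow {1..n}) (Ihat x)"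
      using mode x by (simp add: posterior_mode_def)
    then have I: "Ihat x \<subseteq> {1..n}" and "posterior \<kappa> n \<sigma> x J \<le> posterior \<kappa> n \<sigma> x (Ihat x)"
      using J(1) by (auto simp: is_arg_max_def not_less)
    then have "crit \<kappa> n \<sigma> x (Ihat x) \<le> crit \<kappa> n \<sigma> x J"
      by (intro crit_le_of_posterior_ge J(1) \<sigma>)
    \<comment> \<open>The mode minimizes \<open>crit\<close>, so the difference to the oracle set is
      at most 0. Doubling the inequality bounds the oracle term of the selected set by T/4.\<close>
    then have "(\<Sum>i\<in>{1..n} - Ihat x. (\<theta> i)\<^sup>2) / 2 + 5 / 2 * \<sigma>\<^sup>2 * model_complexity n (Ihat x) \<le> T / 8"
      using crit_diff_ge[OF \<beta> \<kappa> I J(1) M sn] by (simp add: T_def K_def r2_def J(2))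
    moreover have "0 \<le> \<sigma>\<^sup>2 * model_complexity n (Ihat x)" using model_complexity_nonneg[OF I] by simp
    ultimately have "oracle_term n \<sigma> \<theta> (Ihat x) \<le> T"
      using T unfolding oracle_term_def by linarith
    then have "A * oracle_term n \<sigma> \<theta> (Ihat x) \<le> A * (T + 16 * \<sigma>\<^sup>2 * sparsity_const)"
      using A S by (intro mult_left_mono) (auto simp: add_increasing2)
    then show ?thesis
      using vnorm_restr_le[OF \<beta> I sn] unfolding th theta_check_def A_def by linarith
  qed
  also have "\<dots> = (8 * A * K) * r2 + \<sigma>\<^sup>2 * ((8 * A * K + 1 / \<beta>) * M + 16 * A * sparsity_const)"
    using \<beta> by (simp add: T_def field_simps)
  \<comment> \<open>The rate receives the same coefficient as the noise level, so that a single
    constant can play the role of M_1 throughout.\<close>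
  also have "\<dots> \<le> (8 * A * K + 1 / \<beta>) * r2 + \<sigma>\<^sup>2 * ((8 * A * K + 1 / \<beta>) * M + 16 * A * sparsity_const)"
    using r2 \<beta> by (intro add_right_mono mult_right_mono) auto
  finally show ?thesis by (simp add: loss_slope_def loss_offset_def A_def K_def r2_def)
qed

section \<open>Probability bounds\<close>

lemma noise_coord_measurable:
  assumes "sets N = sets (Rn n \<Otimes>\<^sub>M Rn n)" "i \<in> {1..n}"
  shows "(\<lambda>\<omega>. fst \<omega> i) \<in> borel_measurable N" "(\<lambda>\<omega>. snd \<omega> i) \<in> borel_measurable N"
  using assms(2) unfolding measurable_cong_sets[OF assms(1) refl] by measurable

lemma small_noise_observe:
  assumes "0 < \<sigma>"
  shows "small_noise n \<sigma> \<beta> B M \<theta> (observe n \<sigma> \<theta> \<xi>) \<longleftrightarrow>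
    (\<forall>J\<subseteq>{1..n}. (\<Sum>i\<in>J. (\<xi> i)\<^sup>2) \<le> ((2 + B) * model_complexity n J + M) / \<beta>)"
proof -
  have "(\<Sum>i\<in>J. (observe n \<sigma> \<theta> \<xi> i - \<theta> i)\<^sup>2) = \<sigma>\<^sup>2 * (\<Sum>i\<in>J. (\<xi> i)\<^sup>2)" if "J \<subseteq> {1..n}" for J
    unfolding sum_distrib_left using that by (intro sum.cong) (auto simp: observe_def power_mult_distrib)
  then have "(\<Sum>i\<in>J. (observe n \<sigma> \<theta> \<xi> i - \<theta> i)\<^sup>2) \<le> \<sigma>\<^sup>2 * ((2 + B) * model_complexity n J + M) / \<beta> \<longleftrightarrow>
      (\<Sum>i\<in>J. (\<xi> i)\<^sup>2) \<le> ((2 + B) * model_complexity n J + M) / \<beta>" if "J \<subseteq> {1..n}" for J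
    unfolding times_divide_eq_right[symmetric] using that assms by (simp only: mult_le_cancel_left_pos zero_less_power)
  then show ?thesis unfolding small_noise_def by blast
qed

text \<open>A Chernoff bound with exponent \<beta> for each index set, followed by a union bound
  whose sum is controlled by \<open>sum_exp_model_complexity\<close>.\<close>

lemma prob_not_small_noise_le:
  assumes "prob_space N" and sets: "sets N = sets (Rn n \<Otimes>\<^sub>M Rn n)" and exch: "exch_exp_moment n \<beta> B N"
    and \<sigma>: "0 < \<sigma>" and \<beta>: "0 < \<beta>" "0 < B"
  shows "measure N {\<omega> \<in> space N. \<not> small_noise n \<sigma> \<beta> B M \<theta> (observe n \<sigma> \<theta> (fst \<omega>))}
    \<le> sparsity_const * exp (- M)"
proof -
  interpret prob_space N by fact
  define S where "S J \<omega> = (\<Sum>i\<in>J. (fst \<omega> i)\<^sup>2)" for J and \<omega> :: "vec \<times> vec"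
  define a where "a J = ((2 + B) * model_complexity n J + M) / \<beta>" for J
  have S [measurable]: "S J \<in> borel_measurable N" if "J \<subseteq> {1..n}" for J
    unfolding S_def using that by (intro borel_measurable_sum borel_measurable_power noise_coord_measurable[OF sets]) auto
  have ev: "{\<omega> \<in> space N. a J \<le> S J \<omega>} \<in> sets N" if "J \<in> Pow {1..n}" for J
  proof -
    have [measurable]: "S J \<in> borel_measurable N" using that by (intro S) auto
    show ?thesis by measurable
  qed
  have sing: "measure N {\<omega> \<in> space N. a J \<le> S J \<omega>} \<le> exp (- M) * exp (- model_complexity n J - real (card J) / 8)"
    if J: "J \<subseteq> {1..n}" for J
  proof -
    have int: "(\<integral>\<^sup>+\<omega>\<in>space N. ennreal (exp (\<beta> * S J \<omega>)) \<partial>N) \<le> ennreal (exp (B * real (card J)))"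
    proof -
      have "(\<integral>\<^sup>+\<omega>\<in>space N. ennreal (exp (\<beta> * S J \<omega>)) \<partial>N) = (\<integral>\<^sup>+\<omega>. ennreal (exp (\<beta> * S J \<omega>)) \<partial>N)"
        by (intro nn_integral_cong) auto
      then show ?thesis using exch J unfolding exch_exp_moment_def S_def by auto
    qed
    have "emeasure N {\<omega> \<in> space N. a J \<le> S J \<omega>}
       \<le> ennreal (exp (- \<beta> * a J)) * (\<integral>\<^sup>+\<omega>\<in>space N. ennreal (exp (\<beta> * S J \<omega>)) \<partial>N)"
      using S[OF J] \<beta> by (intro Chernoff_ineq_nn_integral_ge) auto
    also have "\<dots> \<le> ennreal (exp (- \<beta> * a J)) * ennreal (exp (B * real (card J)))"
      by (intro mult_left_mono int) simp
    also have "ennreal (exp (- \<beta> * a J)) * ennreal (exp (B * real (card J))) =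
        ennreal (exp (- \<beta> * a J + B * real (card J)))"
      by (simp add: ennreal_mult[symmetric] mult_exp_exp)
    also have "\<dots> \<le> ennreal (exp (- M - model_complexity n J - real (card J) / 8))"
    proof -
      \<comment> \<open>The part B of the coefficient 2 + B cancels B |J|. Of the remaining two
        units of complexity one is kept to offset the number of sets, and the other dominates
        |J|/8.\<close>
      have c: "real (card J) \<le> model_complexity n J" by (rule card_le_model_complexity[OF J])
      then have "B * real (card J) \<le> B * model_complexity n J" using \<beta> by (intro mult_left_mono) auto
      moreover have "\<beta> * a J = 2 * model_complexity n J + B * model_complexity n J + M"
        using \<beta> by (simp add: a_def) (simp add: algebra_simps)
      ultimately have "- \<beta> * a J + B * real (card J) \<le> - M - model_complexity n J - real (card J) / 8"
        using c by simp
      then show ?thesis by (intro ennreal_leI) simp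
    qed
    finally have "measure N {\<omega> \<in> space N. a J \<le> S J \<omega>} \<le> exp (- M - model_complexity n J - real (card J) / 8)"
      by (simp add: emeasure_eq_measure)
    then show ?thesis by (simp add: exp_add[symmetric] algebra_simps)
  qed
  have "measure N {\<omega> \<in> space N. \<not> small_noise n \<sigma> \<beta> B M \<theta> (observe n \<sigma> \<theta> (fst \<omega>))}
     \<le> measure N (\<Union>J\<in>Pow {1..n}. {\<omega> \<in> space N. a J \<le> S J \<omega>})"
  proof (intro finite_measure_mono sets.finite_UN ev)
    show "{\<omega> \<in> space N. \<not> small_noise n \<sigma> \<beta> B M \<theta> (observe n \<sigma> \<theta> (fst \<omega>))}
       \<subseteq> (\<Union>J\<in>Pow {1..n}. {\<omega> \<in> space N. a J \<le> S J \<omega>})"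
      unfolding small_noise_observe[OF \<sigma>] by (auto simp: S_def a_def not_le intro: less_imp_le)
  qed simp
  also have "\<dots> \<le> (\<Sum>J\<in>Pow {1..n}. measure N {\<omega> \<in> space N. a J \<le> S J \<omega>})"
    using ev by (intro finite_measure_subadditive_finite) auto
  also have "\<dots> \<le> (\<Sum>J\<in>Pow {1..n}. exp (- M) * exp (- model_complexity n J - real (card J) / 8))"
    by (intro sum_mono sing) auto
  also have "\<dots> = exp (- M) * (\<Sum>J\<in>Pow {1..n}. exp (- model_complexity n J - real (card J) / 8))"
    by (simp only: sum_distrib_left)
  also have "\<dots> \<le> exp (- M) * sparsity_const"
    by (intro mult_left_mono sum_exp_model_complexity) auto
  finally show ?thesis by (simp add: mult.commute)
qed

section \<open>Measurability and the joint law of the two samples\<close>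

lemma estimator_coord_measurable:
  assumes "\<theta>hat = theta_tilde \<kappa> n \<sigma> \<or>
         (\<exists>Ihat. posterior_mode \<kappa> n \<sigma> Ihat \<and> \<theta>hat = theta_check n Ihat)"
    and i: "i \<in> {1..n}"
  shows "(\<lambda>x. \<theta>hat x i) \<in> borel_measurable (Rn n)"
  using assms(1)
proof (elim disjE exE conjE)
  assume th: "\<theta>hat = theta_tilde \<kappa> n \<sigma>"
  have [measurable]: "(\<lambda>x. marginal n \<sigma> x I) \<in> borel_measurable (Rn n)" for I
    unfolding marginal_def normal_density_def by measurable
  have [measurable]: "(\<lambda>x. restr n x I i) \<in> borel_measurable (Rn n)" for I
    using i by (simp add: restr_def)
  have "(\<lambda>x. \<Sum>I\<in>Pow {1..n}. restr n x I i * posterior \<kappa> n \<sigma> x I) \<in> borel_measurable (Rn n)"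
    unfolding posterior_def by measurable
  then show ?thesis using i by (simp add: th theta_tilde_def)
next
  fix Ihat assume mode: "posterior_mode \<kappa> n \<sigma> Ihat" and th: "\<theta>hat = theta_check n Ihat"
  have "(\<lambda>x. indicator (Ihat x) i :: real) \<in> borel_measurable (Rn n)"
    by (rule measurable_compose[of Ihat _ "count_space (Pow {1..n})"]) (use mode in \<open>auto simp: posterior_mode_def\<close>)
  then show ?thesis using i by (simp add: th theta_check_def restr_def)
qed

lemma observe_measurable [measurable]: "observe n \<sigma> \<theta> \<in> measurable (Rn n) (Rn n)"
  unfolding observe_def by measurable

lemma observe_pair_measurable:
  assumes "sets N = sets (Rn n \<Otimes>\<^sub>M Rn n)"
  shows "(\<lambda>(\<xi>, \<xi>'). (observe n \<sigma> \<theta> \<xi>, observe n \<sigma> \<theta> \<xi>')) \<in> measurable N (Rn n \<Otimes>\<^sub>M Rn n)"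
  unfolding measurable_cong_sets[OF assms refl] by measurable

lemma expectation_second_noise_norm:
  assumes "prob_space N" "second_noise n \<psi>1 \<psi>2 N"
  shows "prob_space.expectation N (\<lambda>\<omega>. (vnorm n (snd \<omega>))\<^sup>2) = real n"
proof -
  interpret prob_space N by fact
  have *: "integrable N (\<lambda>\<omega>. (snd \<omega> i)\<^sup>2)" "expectation (\<lambda>\<omega>. (snd \<omega> i)\<^sup>2) = 1" if "i \<in> {1..n}" for i
  proof -
    have "expectation (\<lambda>\<omega>. snd \<omega> i) = 0" "variance (\<lambda>\<omega>. snd \<omega> i) = 1" "integrable N (\<lambda>\<omega>. (snd \<omega> i)\<^sup>2)"
      using assms(2) that unfolding second_noise_def by blast+
    then show "integrable N (\<lambda>\<omega>. (snd \<omega> i)\<^sup>2)" "expectation (\<lambda>\<omega>. (snd \<omega> i)\<^sup>2) = 1" by simp_all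
  qed
  have "expectation (\<lambda>\<omega>. (vnorm n (snd \<omega>))\<^sup>2) = (\<Sum>i\<in>{1..n}. expectation (\<lambda>\<omega>. (snd \<omega> i)\<^sup>2))"
    unfolding vnorm_sq by (intro Bochner_Integration.integral_sum *)
  also have "\<dots> = real n" using * by simp
  finally show ?thesis .
qed

text \<open>The cross term is bounded conditionally on \<open>X\<close>: by independence the direction \<open>D / \<parallel>D\<parallel>\<close> is then a
  fixed unit vector, to which the tail condition on \<open>\<xi>'\<close> applies.\<close>

lemma joint_law_bound:
  fixes \<theta> :: vec and \<theta>hat :: "vec \<Rightarrow> vec"
  defines "D \<equiv> \<lambda>x i. \<theta> i - \<theta>hat x i" and "z \<equiv> \<lambda>\<sigma> x' i. (x' i - \<theta> i) / \<sigma>"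
  assumes adm: "admissible_noise n \<sigma> \<beta> B \<psi>1 \<psi>2 \<theta> N"
    and \<sigma>: "0 < \<sigma>" and \<beta>: "0 < \<beta>" "0 < B" and M: "0 \<le> M" and \<psi>1: "0 \<le> \<psi>1 (M / 4)"
    and meas: "\<And>i. i \<in> {1..n} \<Longrightarrow> (\<lambda>x. \<theta>hat x i) \<in> borel_measurable (Rn n)"
    and E: "E \<subseteq> space (Rn n \<Otimes>\<^sub>M Rn n)"
    and bad: "\<And>x x'. (x, x') \<in> E \<Longrightarrow> \<not> small_noise n \<sigma> \<beta> B L \<theta> x \<or>
        M * sqrt (real n) \<le> \<bar>(vnorm n (z \<sigma> x'))\<^sup>2 - real n\<bar> \<or>
        vnorm n (D x) \<noteq> 0 \<and> sqrt (M / 4) * vnorm n (D x) \<le> \<bar>scalar n (D x) (z \<sigma> x')\<bar>"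
  shows "measure (joint_law n \<sigma> \<theta> N) E \<le> \<psi>1 (M / 4) + \<psi>2 M + sparsity_const * exp (- L)"
proof -
  have ps: "prob_space N" and sets: "sets N = sets (Rn n \<Otimes>\<^sub>M Rn n)" and exch: "exch_exp_moment n \<beta> B N"
    and sec: "second_noise n \<psi>1 \<psi>2 N"
    and indep: "prob_space.indep_var N (Rn n) (\<lambda>\<omega>. observe n \<sigma> \<theta> (fst \<omega>)) (Rn n) (\<lambda>\<omega>. observe n \<sigma> \<theta> (snd \<omega>))"
    using adm by (auto simp: admissible_noise_def)
  interpret prob_space N by fact
  let ?P = "Rn n \<Otimes>\<^sub>M Rn n" and ?Q = "joint_law n \<sigma> \<theta> N"
  let ?f = "\<lambda>(\<xi>, \<xi>'). (observe n \<sigma> \<theta> \<xi>, observe n \<sigma> \<theta> \<xi>')"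
  have f: "?f \<in> measurable N ?P" by (rule observe_pair_measurable[OF sets])
  interpret Q: prob_space ?Q unfolding joint_law_def by (rule prob_space_distr[OF f])
  have setsQ: "sets ?Q = sets ?P" by (simp add: joint_law_def)
  have z_obs: "z \<sigma> (observe n \<sigma> \<theta> \<xi>) i = \<xi> i" if "i \<in> {1..n}" for i \<xi>
    using that \<sigma> by (simp add: z_def observe_def)
  \<comment> \<open>The three causes of failure: large noise in the first sample, a deviating norm
    of the second noise, and a large cross term.\<close>
  define T1 where "T1 = {p \<in> space ?P. \<not> small_noise n \<sigma> \<beta> B L \<theta> (fst p)}"
  define T2 where "T2 = {p \<in> space ?P. M * sqrt (real n) \<le> \<bar>(vnorm n (z \<sigma> (snd p)))\<^sup>2 - real n\<bar>}"
  define T3 where "T3 = {p \<in> space ?P. vnorm n (D (fst p)) \<noteq> 0 \<and>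
     sqrt (M / 4) * vnorm n (D (fst p)) \<le> \<bar>scalar n (D (fst p)) (z \<sigma> (snd p))\<bar>}"
  have z_meas [measurable]: "(\<lambda>p. z \<sigma> (snd p) i) \<in> borel_measurable ?P" if "i \<in> {1..n}" for i
    using that unfolding z_def by measurable
  have D_meas [measurable]: "(\<lambda>p. D (fst p) i) \<in> borel_measurable ?P" if "i \<in> {1..n}" for i
    using measurable_compose[OF measurable_fst meas[OF that]] unfolding D_def by measurable
  have T1: "T1 \<in> sets ?P"
  proof -
    have "T1 = (\<Union>J\<in>Pow {1..n}. {p \<in> space ?P. \<not> (\<Sum>i\<in>J. (fst p i - \<theta> i)\<^sup>2) \<le> \<sigma>\<^sup>2 * ((2 + B) * model_complexity n J + L) / \<beta>})"
      unfolding T1_def small_noise_def by auto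
    also have "\<dots> \<in> sets ?P"
    proof (intro sets.finite_UN)
      fix J assume "J \<in> Pow {1..n}"
      then have [measurable]: "(\<lambda>p. fst p i) \<in> borel_measurable ?P" if "i \<in> J" for i
        using that by (intro noise_coord_measurable) auto
      show "{p \<in> space ?P. \<not> (\<Sum>i\<in>J. (fst p i - \<theta> i)\<^sup>2) \<le> \<sigma>\<^sup>2 * ((2 + B) * model_complexity n J + L) / \<beta>} \<in> sets ?P"
        by measurable
    qed simp
    finally show ?thesis .
  qed
  have T2: "T2 \<in> sets ?P" unfolding T2_def vnorm_sq by measurable
  have T3: "T3 \<in> sets ?P" unfolding T3_def vnorm_def L2_set_def scalar_def by measurable
  have vim: "measure ?Q T = measure N {\<omega> \<in> space N. ?f \<omega> \<in> T}" if "T \<in> sets ?P" for T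
    unfolding joint_law_def measure_distr[OF f that] by (intro arg_cong[of _ _ "measure N"]) auto
  have sp: "?f \<omega> \<in> space ?P" if "\<omega> \<in> space N" for \<omega>
    using measurable_space[OF f that] .
  have "measure ?Q T1 \<le> sparsity_const * exp (- L)"
  proof -
    have "{\<omega> \<in> space N. ?f \<omega> \<in> T1} = {\<omega> \<in> space N. \<not> small_noise n \<sigma> \<beta> B L \<theta> (observe n \<sigma> \<theta> (fst \<omega>))}"
      using sp by (auto simp: T1_def)
    then show ?thesis
      using prob_not_small_noise_le[OF ps sets exch \<sigma> \<beta>] by (simp add: vim[OF T1])
  qed
  moreover have "measure ?Q T2 \<le> \<psi>2 M"
  proof -
    have "(vnorm n (z \<sigma> (observe n \<sigma> \<theta> \<xi>)))\<^sup>2 = (vnorm n \<xi>)\<^sup>2" for \<xi>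
      unfolding vnorm_sq by (intro sum.cong) (auto simp: z_obs)
    then have "{\<omega> \<in> space N. ?f \<omega> \<in> T2} =
       {\<omega> \<in> space N. \<bar>(vnorm n (snd \<omega>))\<^sup>2 - expectation (\<lambda>\<omega>. (vnorm n (snd \<omega>))\<^sup>2)\<bar> \<ge> M * sqrt (real n)}"
      unfolding expectation_second_noise_norm[OF ps sec] using sp by (auto simp: T2_def)
    then show ?thesis
      using sec M by (simp add: vim[OF T2] second_noise_def)
  qed
  moreover have "measure ?Q T3 \<le> \<psi>1 (M / 4)"
  proof -
    let ?X = "\<lambda>\<omega>. observe n \<sigma> \<theta> (fst \<omega>)" and ?X' = "\<lambda>\<omega>. observe n \<sigma> \<theta> (snd \<omega>)"
    have X: "?X \<in> measurable N (Rn n)" and X': "?X' \<in> measurable N (Rn n)"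
      and prod: "distr N (Rn n) ?X \<Otimes>\<^sub>M distr N (Rn n) ?X' = ?Q"
      using indep unfolding indep_var_distribution_eq joint_law_def by (auto simp: case_prod_beta')
    interpret PX: prob_space "distr N (Rn n) ?X" by (rule prob_space_distr[OF X])
    interpret PX': prob_space "distr N (Rn n) ?X'" by (rule prob_space_distr[OF X'])
    have "emeasure (distr N (Rn n) ?X') (Pair x -` T3) \<le> ennreal (\<psi>1 (M / 4))" for x
    proof -
      have "emeasure (distr N (Rn n) ?X') (Pair x -` T3) = emeasure N (?X' -` (Pair x -` T3) \<inter> space N)"
        by (intro emeasure_distr X' sets_Pair1[OF T3])
      also have "\<dots> \<le> ennreal (\<psi>1 (M / 4))"
      \<comment> \<open>If the estimator hits the parameter there is no direction to normalize;
        \<open>T3\<close> excludes this case, so its section is empty.\<close>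
      proof (cases "vnorm n (D x) = 0")
        case True
        then have "?X' -` (Pair x -` T3) \<inter> space N = {}" by (auto simp: T3_def)
        then show ?thesis by (metis emeasure_empty zero_le)
      next
        case False
        define d where "d = vnorm n (D x)"
        have d: "d > 0" using False unfolding d_def vnorm_def by (simp add: order_less_le)
        define v where "v = (\<lambda>i\<in>{1..n}. D x i / d)"
        have "(vnorm n v)\<^sup>2 = (\<Sum>i\<in>{1..n}. (D x i)\<^sup>2 / d\<^sup>2)"
          unfolding vnorm_sq v_def by (intro sum.cong) (auto simp: power_divide)
        also have "\<dots> = 1" using d by (simp only: sum_divide_distrib[symmetric] vnorm_sq[symmetric] d_def) simp
        finally have v1: "vnorm n v = 1" by (simp add: vnorm_def power2_eq_1_iff) (smt (verit) L2_set_nonneg)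
        have "v \<in> space (Rn n)" by (simp add: v_def space_PiM)
        then have psi: "measure N {\<omega> \<in> space N. \<bar>scalar n v (snd \<omega>)\<bar> \<ge> sqrt (M / 4)} \<le> \<psi>1 (M / 4)"
          using sec v1 M unfolding second_noise_def by simp
        have sc: "scalar n (D x) (z \<sigma> (observe n \<sigma> \<theta> \<xi>)) = d * scalar n v \<xi>" for \<xi>
          unfolding scalar_def sum_distrib_left using d by (intro sum.cong) (auto simp: z_obs v_def)
        have "?X' -` (Pair x -` T3) \<inter> space N \<subseteq> {\<omega> \<in> space N. \<bar>scalar n v (snd \<omega>)\<bar> \<ge> sqrt (M / 4)}"
          using d by (auto simp: T3_def sc d_def[symmetric] abs_mult mult.commute)
        moreover have "{\<omega> \<in> space N. \<bar>scalar n v (snd \<omega>)\<bar> \<ge> sqrt (M / 4)} \<in> sets N"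
        proof -
          note [measurable] = noise_coord_measurable[OF sets]
          show ?thesis unfolding scalar_def by measurable
        qed
        ultimately have "emeasure N (?X' -` (Pair x -` T3) \<inter> space N) \<le>
            emeasure N {\<omega> \<in> space N. \<bar>scalar n v (snd \<omega>)\<bar> \<ge> sqrt (M / 4)}"
          by (intro emeasure_mono)
        also have "\<dots> \<le> ennreal (\<psi>1 (M / 4))" using psi by (simp add: emeasure_eq_measure ennreal_leI)
        finally show ?thesis .
      qed
      finally show ?thesis .
    qed
    then have "(\<integral>\<^sup>+x. emeasure (distr N (Rn n) ?X') (Pair x -` T3) \<partial>distr N (Rn n) ?X)
        \<le> (\<integral>\<^sup>+x. ennreal (\<psi>1 (M / 4)) \<partial>distr N (Rn n) ?X)"
      by (intro nn_integral_mono) auto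
    also have "\<dots> = ennreal (\<psi>1 (M / 4))" using PX.emeasure_space_1 by simp
    \<comment> \<open>By independence the joint law is a product, so the probability of
      \<open>T3\<close> is the average of the probabilities of its sections.\<close>
    also have "(\<integral>\<^sup>+x. emeasure (distr N (Rn n) ?X') (Pair x -` T3) \<partial>distr N (Rn n) ?X) = emeasure ?Q T3"
      unfolding prod[symmetric] using T3 by (intro PX'.emeasure_pair_measure_alt[symmetric]) simp
    finally have "ennreal (measure ?Q T3) \<le> ennreal (\<psi>1 (M / 4))" by (simp add: Q.emeasure_eq_measure)
    then show ?thesis using \<psi>1 by simp
  qed
  \<comment> \<open>Monotonicity asks for measurability of the covering union only.\<close>
  moreover have "measure ?Q E \<le> measure ?Q (T1 \<union> T2 \<union> T3)"
  proof (intro Q.finite_measure_mono subsetI)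
    fix p assume p: "p \<in> E"
    then have "p \<in> space ?P" using E by blast
    then show "p \<in> T1 \<union> T2 \<union> T3"
      using bad[of "fst p" "snd p"] p unfolding T1_def T2_def T3_def prod.collapse by blast
  qed (use T1 T2 T3 setsQ in auto)
  moreover have "measure ?Q (T1 \<union> T2 \<union> T3) \<le> measure ?Q T1 + measure ?Q T2 + measure ?Q T3"
    using T1 T2 T3 setsQ measure_Un_le[of "T1 \<union> T2" ?Q T3] measure_Un_le[of T1 ?Q T2] by simp
  ultimately show ?thesis by linarith
qed

section \<open>Size of the random terms in the squared radius\<close>

lemma fluctuation_bound:
  assumes "0 < \<sigma>" "0 < M" "0 \<le> M1" "1 \<le> n"
    and D: "(vnorm n D)\<^sup>2 \<le> M1 * oracle_rate2 n \<sigma> \<theta> + M * \<sigma>\<^sup>2"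
    and z: "\<bar>(vnorm n z)\<^sup>2 - real n\<bar> < M * sqrt (real n)"
    and c: "vnorm n D = 0 \<or> \<bar>scalar n D z\<bar> < sqrt (M / 4) * vnorm n D"
  shows "\<bar>2 * \<sigma> * scalar n D z + \<sigma>\<^sup>2 * ((vnorm n z)\<^sup>2 - real n)\<bar> < 2 * \<sigma>\<^sup>2 * GM M1 M * sqrt (real n)"
proof -
  have nn: "0 \<le> vnorm n D" by (simp add: vnorm_def)
  have "\<bar>scalar n D z\<bar> \<le> sqrt (M / 4) * vnorm n D"
  \<comment> \<open>For D = 0 the strict inequality of the hypothesis cannot hold, but then the
    scalar product vanishes and the weak one does.\<close>
  proof (cases "vnorm n D = 0")
    case True
    then have "\<forall>i\<in>{1..n}. D i = 0" unfolding vnorm_def by (subst (asm) L2_set_eq_0_iff) auto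
    then show ?thesis using True by (simp add: scalar_def)
  qed (use c in auto)
  also have "vnorm n D \<le> \<sigma> * sqrt (real n) * sqrt (M + M1)"
  proof (rule power2_le_imp_le)
    have "M1 * oracle_rate2 n \<sigma> \<theta> \<le> M1 * (real n * \<sigma>\<^sup>2)"
      using assms oracle_rate2_le by (intro mult_left_mono) auto
    \<comment> \<open>Both summands of the loss bound are brought to order n \<sigma>^2, the second
      one through n >= 1.\<close>
    moreover have "1 * (M * \<sigma>\<^sup>2) \<le> real n * (M * \<sigma>\<^sup>2)" using assms by (intro mult_right_mono) auto
    ultimately have "(vnorm n D)\<^sup>2 \<le> M1 * (real n * \<sigma>\<^sup>2) + real n * (M * \<sigma>\<^sup>2)"
      using D by linarith
    then show "(vnorm n D)\<^sup>2 \<le> (\<sigma> * sqrt (real n) * sqrt (M + M1))\<^sup>2"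
      using assms by (simp add: power_mult_distrib algebra_simps)
  qed (use assms in auto)
  finally have "\<bar>scalar n D z\<bar> \<le> sqrt (M / 4) * (\<sigma> * sqrt (real n) * sqrt (M + M1))"
    using assms by (simp add: mult_left_mono)
  \<comment> \<open>The root of M/4 times the root of M + M_1 is G_M / 2, so the doubled cross term
    uses up exactly half of the allowed deviation.\<close>
  also have "\<dots> = \<sigma> * sqrt (real n) * GM M1 M / 2"
    using assms by (simp add: GM_def real_sqrt_mult real_sqrt_divide)
  finally have "2 * \<sigma> * \<bar>scalar n D z\<bar> \<le> 2 * \<sigma> * (\<sigma> * sqrt (real n) * GM M1 M / 2)"
    using assms by (intro mult_left_mono) auto
  then have 1: "\<bar>2 * \<sigma> * scalar n D z\<bar> \<le> \<sigma>\<^sup>2 * GM M1 M * sqrt (real n)"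
    using assms by (simp add: abs_mult power2_eq_square algebra_simps)
  \<comment> \<open>This fits the deviation of the squared noise norm into the other half; its
    strictness makes the sum strict.\<close>
  have "M \<le> GM M1 M" unfolding GM_def using assms by (intro real_le_rsqrt) (auto simp: power2_eq_square)
  then have "M * sqrt (real n) \<le> GM M1 M * sqrt (real n)" by (intro mult_right_mono) auto
  then have "\<sigma>\<^sup>2 * \<bar>(vnorm n z)\<^sup>2 - real n\<bar> < \<sigma>\<^sup>2 * (GM M1 M * sqrt (real n))"
    using z assms(1) by (intro mult_strict_left_mono) (linarith, simp)
  then have "\<bar>\<sigma>\<^sup>2 * ((vnorm n z)\<^sup>2 - real n)\<bar> < \<sigma>\<^sup>2 * GM M1 M * sqrt (real n)" by (simp add: abs_mult)
  then show ?thesis using 1 by linarith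
qed

lemma vnorm_sq_decompose:
  assumes "0 < \<sigma>"
  shows "(vnorm n (\<lambda>i. x' i - t i))\<^sup>2 = (vnorm n (\<lambda>i. \<theta> i - t i))\<^sup>2 +
    2 * \<sigma> * scalar n (\<lambda>i. \<theta> i - t i) (\<lambda>i. (x' i - \<theta> i) / \<sigma>) + \<sigma>\<^sup>2 * (vnorm n (\<lambda>i. (x' i - \<theta> i) / \<sigma>))\<^sup>2"
  unfolding vnorm_sq scalar_def sum_distrib_left sum.distrib[symmetric]
  using assms by (intro sum.cong) (auto simp: field_simps power2_eq_square)

section \<open>Choice of constants and conclusion\<close>

theorem theorem4:
  fixes \<beta> B \<kappa> :: real
  assumes "0 < \<beta>" "\<beta> \<le> 1" "0 < B"
    and "1 < \<kappa>" "\<kappa> > (12 - \<beta> + 4 * B) / (4 * \<beta>)"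
  shows "\<exists>M1 H1 m1 :: real. M1 > 0 \<and> H1 > 0 \<and> m1 > 0 \<and>
    (\<forall>(n::nat) (\<sigma>::real) (\<psi>1::real \<Rightarrow> real) (\<psi>2::real \<Rightarrow> real)
       (N :: vec \<Rightarrow> (vec \<times> vec) measure) (\<theta>hat :: vec \<Rightarrow> vec) (M::real).
       n \<ge> 1 \<longrightarrow> \<sigma> > 0 \<longrightarrow> tail_function \<psi>1 \<longrightarrow> tail_function \<psi>2 \<longrightarrow>
       (\<forall>\<theta>\<in>space (Rn n). admissible_noise n \<sigma> \<beta> B \<psi>1 \<psi>2 \<theta> (N \<theta>)) \<longrightarrow>
       (\<theta>hat = theta_tilde \<kappa> n \<sigma> \<or>
         (\<exists>Ihat. posterior_mode \<kappa> n \<sigma> Ihat \<and> \<theta>hat = theta_check n Ihat)) \<longrightarrow>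
       M \<ge> 0 \<longrightarrow>
         (SUP \<theta>\<in>space (Rn n). measure (joint_law n \<sigma> \<theta> (N \<theta>))
            {(x, x') \<in> space (Rn n \<Otimes>\<^sub>M Rn n).
               \<theta> \<notin> vball n (\<theta>hat x) (sqrt (radius2 M1 n \<sigma> M (\<theta>hat x) x'))})
           \<le> \<psi>1 (M / 4) + \<psi>2 M + H1 * exp (- m1 * M) \<and>
         (SUP \<theta>\<in>space (Rn n). measure (joint_law n \<sigma> \<theta> (N \<theta>))
            {(x, x') \<in> space (Rn n \<Otimes>\<^sub>M Rn n).
               radius2 M1 n \<sigma> M (\<theta>hat x) x' \<ge> gM M1 n \<sigma> M \<theta>})
           \<le> \<psi>1 (M / 4) + \<psi>2 M + 2 * H1 * exp (- m1 * M))"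
proof -
  define M1 where "M1 = loss_slope \<beta> B \<kappa>"
  define c where "c = loss_offset \<beta> B"
  \<comment> \<open>The factor exp(c / M_1) compensates the shift by \<open>c\<close> in the noise
    level \<open>L\<close> used below.\<close>
  define H1 where "H1 = sparsity_const * exp (c / M1)"
  have S: "1 \<le> sparsity_const" by (rule sparsity_const_ge_1)
  have M1: "0 < M1"
    using crit_const_pos[OF assms(1,3,4)] assms(1,3) by (simp add: M1_def loss_slope_def add_pos_pos)
  have c: "0 < c" using S assms(1,3) by (simp add: c_def loss_offset_def)
  have H1: "0 < H1" using S by (simp add: H1_def)
  have bounds:
    "measure (joint_law n \<sigma> \<theta> N) {(x, x') \<in> space (Rn n \<Otimes>\<^sub>M Rn n).
        \<theta> \<notin> vball n (\<theta>hat x) (sqrt (radius2 M1 n \<sigma> M (\<theta>hat x) x'))}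
      \<le> \<psi>1 (M / 4) + \<psi>2 M + H1 * exp (- (1 / M1) * M)" (is "measure _ ?E1 \<le> _")
    "measure (joint_law n \<sigma> \<theta> N) {(x, x') \<in> space (Rn n \<Otimes>\<^sub>M Rn n).
        radius2 M1 n \<sigma> M (\<theta>hat x) x' \<ge> gM M1 n \<sigma> M \<theta>}
      \<le> \<psi>1 (M / 4) + \<psi>2 M + H1 * exp (- (1 / M1) * M)" (is "measure _ ?E2 \<le> _")
    if n: "1 \<le> n" and \<sigma>: "0 < \<sigma>" and tail: "tail_function \<psi>1" "tail_function \<psi>2" and \<theta>: "\<theta> \<in> space (Rn n)"
      and adm: "admissible_noise n \<sigma> \<beta> B \<psi>1 \<psi>2 \<theta> N"
      and est: "\<theta>hat = theta_tilde \<kappa> n \<sigma> \<or> (\<exists>Ihat. posterior_mode \<kappa> n \<sigma> Ihat \<and> \<theta>hat = theta_check n Ihat)"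
      and M: "0 \<le> M"
    for n \<sigma> \<psi>1 \<psi>2 \<theta> N \<theta>hat M
  proof -
    \<comment> \<open>The solution of M_1 L + c = M: with this noise level the loss bound becomes
      M_1 r^2 + M \<sigma>^2.\<close>
    define L where "L = (M - c) / M1"
    have HL: "H1 * exp (- (1 / M1) * M) = sparsity_const * exp (- L)"
      by (simp add: H1_def L_def exp_add[symmetric] diff_divide_distrib)
    have "measure (joint_law n \<sigma> \<theta> N) ?E1 \<le> \<psi>1 (M / 4) + \<psi>2 M + sparsity_const * exp (- L) \<and>
          measure (joint_law n \<sigma> \<theta> N) ?E2 \<le> \<psi>1 (M / 4) + \<psi>2 M + sparsity_const * exp (- L)"
    proof (cases "L < 0")
      \<comment> \<open>For negative \<open>L\<close> the exponential term alone is at least 1, so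
        the bounds are trivial.\<close>
      case True
      have "prob_space N" "sets N = sets (Rn n \<Otimes>\<^sub>M Rn n)" using adm by (auto simp: admissible_noise_def)
      then interpret Q: prob_space "joint_law n \<sigma> \<theta> N"
        unfolding joint_law_def by (intro prob_space.prob_space_distr observe_pair_measurable)
      have "1 * 1 \<le> sparsity_const * exp (- L)" using S True by (intro mult_mono) auto
      moreover have "0 < \<psi>1 (M / 4)" "0 < \<psi>2 M" using tail M by (auto simp: tail_function_def)
      moreover have "measure (joint_law n \<sigma> \<theta> N) ?E1 \<le> 1" "measure (joint_law n \<sigma> \<theta> N) ?E2 \<le> 1"
        by (rule Q.prob_le_1)+
      ultimately show ?thesis by linarith
    next
      case False
      then have L: "0 \<le> L" by simp
      then have Mpos: "0 < M" using M1 c by (simp add: L_def zero_le_divide_iff)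
      have M_eq: "M1 * L + c = M" using M1 by (simp add: L_def)
      have "vnorm n (\<lambda>i. \<theta>hat x i - \<theta> i) = vnorm n (\<lambda>i. \<theta> i - \<theta>hat x i)" for x
        unfolding vnorm_def L2_set_def by (simp add: power2_commute)
      then have loss: "(vnorm n (\<lambda>i. \<theta> i - \<theta>hat x i))\<^sup>2 \<le> M1 * oracle_rate2 n \<sigma> \<theta> + M * \<sigma>\<^sup>2"
        if "x \<in> space (Rn n)" "small_noise n \<sigma> \<beta> B L \<theta> x" for x
        using loss_bound[OF assms \<sigma> L that(2,1) est] unfolding M1_def[symmetric] c_def[symmetric] M_eq
        by (simp add: mult.commute)
      \<comment> \<open>Failure of coverage and an overly large radius have the same causes, so a
        single contradiction argument treats both.\<close>
      have fluct: "\<not> small_noise n \<sigma> \<beta> B L \<theta> x \<or>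
          M * sqrt (real n) \<le> \<bar>(vnorm n (\<lambda>i. (x' i - \<theta> i) / \<sigma>))\<^sup>2 - real n\<bar> \<or>
          vnorm n (\<lambda>i. \<theta> i - \<theta>hat x i) \<noteq> 0 \<and> sqrt (M / 4) * vnorm n (\<lambda>i. \<theta> i - \<theta>hat x i)
            \<le> \<bar>scalar n (\<lambda>i. \<theta> i - \<theta>hat x i) (\<lambda>i. (x' i - \<theta> i) / \<sigma>)\<bar>"
        if x: "x \<in> space (Rn n)" and fail: "\<theta> \<notin> vball n (\<theta>hat x) (sqrt (radius2 M1 n \<sigma> M (\<theta>hat x) x')) \<or>
            radius2 M1 n \<sigma> M (\<theta>hat x) x' \<ge> gM M1 n \<sigma> M \<theta>" for x x'
      proof (rule ccontr)
        let ?D = "\<lambda>i. \<theta> i - \<theta>hat x i" and ?z = "\<lambda>i. (x' i - \<theta> i) / \<sigma>"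
        let ?G = "2 * \<sigma>\<^sup>2 * GM M1 M * sqrt (real n)"
        assume neg: "\<not> ?thesis"
        then have D: "(vnorm n ?D)\<^sup>2 \<le> M1 * oracle_rate2 n \<sigma> \<theta> + M * \<sigma>\<^sup>2" using loss x by blast
        have fl: "\<bar>2 * \<sigma> * scalar n ?D ?z + \<sigma>\<^sup>2 * ((vnorm n ?z)\<^sup>2 - real n)\<bar> < ?G"
          using neg by (intro fluctuation_bound[OF \<sigma> Mpos less_imp_le[OF M1] n D]) auto
        define R where "R = (vnorm n (\<lambda>i. x' i - \<theta>hat x i))\<^sup>2 - real n * \<sigma>\<^sup>2 + ?G"
        have R: "R = (vnorm n ?D)\<^sup>2 + (2 * \<sigma> * scalar n ?D ?z + \<sigma>\<^sup>2 * ((vnorm n ?z)\<^sup>2 - real n)) + ?G"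
          unfolding R_def vnorm_sq_decompose[OF \<sigma>, of n x' "\<theta>hat x" \<theta>] by (simp add: algebra_simps)
        have rad: "radius2 M1 n \<sigma> M (\<theta>hat x) x' = max R 0" by (simp add: radius2_def R_def)
        have "(vnorm n ?D)\<^sup>2 \<le> max R 0" using fl R by linarith
        then have "vnorm n ?D \<le> sqrt (max R 0)" by (rule real_le_rsqrt)
        then have "\<theta> \<in> vball n (\<theta>hat x) (sqrt (radius2 M1 n \<sigma> M (\<theta>hat x) x'))"
          using \<theta> by (simp add: vball_def rad vnorm_def L2_set_def power2_commute)
        \<comment> \<open>In g_M one \<open>?G\<close> is the correction built into the radius and
          the other bounds the fluctuation. Positivity of M \<sigma>^2 handles the truncation at
          0.\<close>
        moreover have "max R 0 < gM M1 n \<sigma> M \<theta>"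
        proof -
          have "gM M1 n \<sigma> M \<theta> = M1 * oracle_rate2 n \<sigma> \<theta> + M * \<sigma>\<^sup>2 + 2 * ?G" by (simp add: gM_def)
          moreover have "0 \<le> M1 * oracle_rate2 n \<sigma> \<theta>" using M1 oracle_rate2_nonneg[of n \<sigma> \<theta>] by simp
          moreover have "0 < M * \<sigma>\<^sup>2" using Mpos \<sigma> by simp
          ultimately show ?thesis using fl R D by linarith
        qed
        ultimately show False using fail unfolding rad by linarith
      qed
      have "0 \<le> \<psi>1 (M / 4)" using tail(1) M by (simp add: tail_function_def less_imp_le)
      note jb = joint_law_bound[OF adm \<sigma> assms(1,3) M this estimator_coord_measurable[OF est], where L=L]
      show ?thesis
        by (intro conjI jb) (use fluct in \<open>auto simp: space_pair_measure\<close>)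
    qed
    then show "measure (joint_law n \<sigma> \<theta> N) ?E1 \<le> \<psi>1 (M / 4) + \<psi>2 M + H1 * exp (- (1 / M1) * M)"
      and "measure (joint_law n \<sigma> \<theta> N) ?E2 \<le> \<psi>1 (M / 4) + \<psi>2 M + H1 * exp (- (1 / M1) * M)"
      unfolding HL by auto
  qed
  \<comment> \<open>A supremum of reals is bounded by a common upper bound only over a nonempty
    index set.\<close>
  have ne: "space (Rn n) \<noteq> {}" for n by (simp add: space_PiM PiE_eq_empty_iff)
  \<comment> \<open>Both events satisfy the bound with \<open>H1\<close>; for the radius it is
    relaxed to the stated factor 2.\<close>
  have H2: "H1 * exp (- (1 / M1) * M) \<le> 2 * H1 * exp (- (1 / M1) * M)" for M
    using H1 by simp
  show ?thesis
  proof (rule exI[of _ M1], rule exI[of _ H1], rule exI[of _ "1 / M1"], intro conjI allI impI)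
    show "M1 > 0" "H1 > 0" "1 / M1 > 0" using M1 H1 by simp_all
  next
    fix n \<sigma> \<psi>1 \<psi>2 and N :: "vec \<Rightarrow> (vec \<times> vec) measure" and \<theta>hat and M :: real
    assume hyps: "1 \<le> n" "0 < \<sigma>" "tail_function \<psi>1" "tail_function \<psi>2"
      "\<forall>\<theta>\<in>space (Rn n). admissible_noise n \<sigma> \<beta> B \<psi>1 \<psi>2 \<theta> (N \<theta>)"
      "\<theta>hat = theta_tilde \<kappa> n \<sigma> \<or> (\<exists>Ihat. posterior_mode \<kappa> n \<sigma> Ihat \<and> \<theta>hat = theta_check n Ihat)" "0 \<le> M"
    note b = bounds[OF hyps(1-4) _ _ hyps(6,7)] and adm = bspec[OF hyps(5)]
    show "(SUP \<theta>\<in>space (Rn n). measure (joint_law n \<sigma> \<theta> (N \<theta>)) {(x, x') \<in> space (Rn n \<Otimes>\<^sub>M Rn n).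
           \<theta> \<notin> vball n (\<theta>hat x) (sqrt (radius2 M1 n \<sigma> M (\<theta>hat x) x'))})
         \<le> \<psi>1 (M / 4) + \<psi>2 M + H1 * exp (- (1 / M1) * M)"
      by (intro cSUP_least ne b(1) adm)
    show "(SUP \<theta>\<in>space (Rn n). measure (joint_law n \<sigma> \<theta> (N \<theta>)) {(x, x') \<in> space (Rn n \<Otimes>\<^sub>M Rn n).
           radius2 M1 n \<sigma> M (\<theta>hat x) x' \<ge> gM M1 n \<sigma> M \<theta>})
         \<le> \<psi>1 (M / 4) + \<psi>2 M + 2 * H1 * exp (- (1 / M1) * M)"
      by (intro cSUP_least ne order_trans[OF b(2)] adm add_left_mono H2)
  qed
qed

end
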